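(* For every integer $n\ge 1$, the polynomial $$\prod_{k=1}^{n}\bigl(T_k(d)+(-1)^k z\bigr)^{\binom{2n}{n-k}}$$ divides the Gram determinant $D_n^{(Mb)_1}(d,z,x,y,w)$ of type $(Mb)_1$ in the polynomial ring $\mathbb{Z}[d,x,y,z,w]$.
   Context: Let $Mb$ be the Möbius band and fix $2n$ marked points $x_1,\dots,x_{2n}$ on its boundary circle. A crossingless connection is a collection of $n$ pairwise disjoint embedded arcs in $Mb$ whose endpoints are exactly the $2n$ marked points, with no closed components, considered up to isotopy fixing the boundary. Let $Mb_{n,0}$ be the set of crossingless connections none of whose arcs passes through the crosscap (i.e. every arc is contained in a disk in $Mb$; there are $\binom{2n}{n}$ of them), and let $Mb_{n,1}$ be the set of crossingless connections in which exactly one arc passes through the crosscap (once), i.e. exactly one arc is not contained in a disk (there are $\binom{2n}{n-1}$ of them). Put $(Mb_n)_1=Mb_{n,0}\cup Mb_{n,1}$, a set with $\binom{2n}{n}+\binom{2n}{n-1}$ elements. Bilinear form: for $m_i,m_j\in (Mb_n)_1$, glue the Möbius band carrying $m_i$ to a second Möbius band carrying the mirror image of $m_j$ along their boundaries, identifying marked points with the same labels. The result is a Klein bottle containing a disjoint union of simple closed curves. Every such curve is isotopic to one of five classes: $d$ (null-homotopic curve), $z$ (the separating two-sided curve parallel to the common boundary of the two Möbius bands), $x$ (the one-sided core curve of the first Möbius band, the one carrying $m_i$), $y$ (the one-sided core curve of the second Möbius band, carrying the image of $m_j$), and $w$ (the non-separating two-sided curve passing once through each of the two crosscaps). Define $\langle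 m_i,m_j\rangle=d^{a}x^{b}y^{c}z^{e}w^{h}$, where $a,b,c,e,h$ are the numbers of curves of each class. The Gram matrix of type $(Mb)_1$ is $G_n^{(Mb)_1}=(\langle m_i,m_j\rangle)_{m_i,m_j\in (Mb_n)_1}$ (any fixed ordering of $(Mb_n)_1$, used for rows and columns), and $D_n^{(Mb)_1}=\det G_n^{(Mb)_1}\in\mathbb{Z}[d,x,y,z,w]$. $T_k$ denotes the Chebyshev polynomial of the first kind defined by $T_0(d)=2$, $T_1(d)=d$, $T_{k+1}(d)=d\,T_k(d)-T_{k-1}(d)$. *)

theory Defs
  imports "HOL-Computational_Algebra.Polynomial" "HOL-Combinatorics.Permutations"
begin

section \<open>The polynomial ring Z[d,x,y,z,w]\<close>

text \<open>Z[d,x,y,z,w] is rendered as the iterated univariate polynomial ring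
  Z[d][x][y][z][w] (canonically isomorphic as rings).\<close>

type_synonym mpoly5 = "int poly poly poly poly poly"

definition var_d :: mpoly5 where "var_d = [:[:[:[:[:0, 1:]:]:]:]:]"
definition var_x :: mpoly5 where "var_x = [:[:[:[:0, 1:]:]:]:]"
definition var_y :: mpoly5 where "var_y = [:[:[:0, 1:]:]:]"
definition var_z :: mpoly5 where "var_z = [:[:0, 1:]:]"
definition var_w :: mpoly5 where "var_w = [:0, 1:]"

text \<open>Chebyshev polynomials of the first kind in the variable d:
  T_0 = 2, T_1 = d, T_(k+1) = d T_k - T_(k-1).\<close>
fun cheb :: "nat \<Rightarrow> mpoly5" where
  "cheb 0 = 2"
| "cheb (Suc 0) = var_d"
| "cheb (Suc (Suc k)) = var_d * cheb (Suc k) - cheb k"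

section \<open>Combinatorial model of crossingless connections in the Moebius band\<close>

text \<open>Marked points are 0,...,2n-1 in cyclic order on the boundary circle.
  An arc is a 2-element set of marked points. Gap g (g < 2n) is the boundary
  segment between points g and g+1 (mod 2n).\<close>

definition perfect_matching :: "nat \<Rightarrow> nat set set \<Rightarrow> bool" where
  "perfect_matching n M \<longleftrightarrow>
     (\<forall>a\<in>M. \<exists>p q. a = {p, q} \<and> p < q \<and> q < 2 * n) \<and>
     (\<forall>p < 2 * n. \<exists>!a. a \<in> M \<and> p \<in> a)"

definition noncrossing :: "nat set set \<Rightarrow> bool" where
  "noncrossing M \<longleftrightarrow>
     (\<forall>p q r s. {p, q} \<in> M \<longrightarrow> {r, s} \<in> M \<longrightarrow> \<not> (p < r \<and> r < q \<and> q < s))"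

definition NC :: "nat \<Rightarrow> nat set set set" where
  "NC n = {M. perfect_matching n M \<and> noncrossing M}"

text \<open>The face of the chord diagram M (in the disk) containing gap g, given as the
  set of gaps lying in it: two gaps are in the same face iff no arc separates them.\<close>
definition region :: "nat \<Rightarrow> nat set set \<Rightarrow> nat \<Rightarrow> nat set" where
  "region n M g = {g'. g' < 2 * n \<and>
     (\<forall>a\<in>M. (Min a \<le> g \<and> g < Max a) \<longleftrightarrow> (Min a \<le> g' \<and> g' < Max a))}"

text \<open>The Moebius band is modelled as a disk with a crosscap at an interior point c.
  \<open>Free M R\<close>: no arc passes through the crosscap; M is the (noncrossing) chord
  diagram and R the face of M containing c (element of Mb_{n,0}).
  \<open>Cap M a\<close>: the arc a \<in> M passes once through the crosscap, the other arcs
  of M are contained in disks (element of Mb_{n,1}).\<close>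
datatype conn = Free "nat set set" "nat set" | Cap "nat set set" "nat set"

definition Mb0 :: "nat \<Rightarrow> conn set" where
  "Mb0 n = {Free M (region n M g) | M g. M \<in> NC n \<and> g < 2 * n}"

definition Mb1 :: "nat \<Rightarrow> conn set" where
  "Mb1 n = {Cap M a | M a. M \<in> NC n \<and> a \<in> M}"

definition Mb_1 :: "nat \<Rightarrow> conn set" where
  "Mb_1 n = Mb0 n \<union> Mb1 n"

fun arcs_of :: "conn \<Rightarrow> nat set set" where
  "arcs_of (Free M R) = M"
| "arcs_of (Cap M a) = M"

text \<open>A position on the boundary circle (doubled coordinates: point p is 2p, gap g
  is 2g+1) reachable from the crosscap point c without crossing any arc that does
  not pass through the crosscap.\<close>
fun ref_pos :: "conn \<Rightarrow> nat" where
  "ref_pos (Free M R) = 2 * Min R + 1"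
| "ref_pos (Cap M a) = 2 * Min a"

text \<open>Does the closed curve with vertex set \<gamma> use the crosscap arc?\<close>
fun uses_cap :: "conn \<Rightarrow> nat set \<Rightarrow> bool" where
  "uses_cap (Free M R) \<gamma> = False"
| "uses_cap (Cap M a) \<gamma> = (a \<subseteq> \<gamma>)"

text \<open>Gluing: the Klein bottle is the sphere D1 \<union> D2 (glued along the circle
  through the marked points) with two crosscaps c1 \<in> D1, c2 \<in> D2. Closed curves
  are the connected components of the graph on the marked points whose edges are
  the arcs of both connections.\<close>
definition curves :: "nat \<Rightarrow> conn \<Rightarrow> conn \<Rightarrow> nat set set" where
  "curves n m1 m2 = {0..<2 * n} // ({(p, q). {p, q} \<in> arcs_of m1 \<union> arcs_of m2}\<^sup>*)"

text \<open>For a curve not through any crosscap: it separates c1 from c2 on the sphere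
  iff it crosses the boundary circle an odd number of times between the two
  reference positions.\<close>
definition separates :: "conn \<Rightarrow> conn \<Rightarrow> nat set \<Rightarrow> bool" where
  "separates m1 m2 \<gamma> \<longleftrightarrow>
     odd (card {v \<in> \<gamma>. min (ref_pos m1) (ref_pos m2) < 2 * v \<and>
                       2 * v < max (ref_pos m1) (ref_pos m2)})"

definition curve_class :: "conn \<Rightarrow> conn \<Rightarrow> nat set \<Rightarrow> mpoly5" where
  "curve_class m1 m2 \<gamma> =
     (if uses_cap m1 \<gamma> \<and> uses_cap m2 \<gamma> then var_w
      else if uses_cap m1 \<gamma> then var_x
      else if uses_cap m2 \<gamma> then var_y
      else if separates m1 m2 \<gamma> then var_z
      else var_d)"

text \<open>The bilinear form \<langle>m1, m2\<rangle> = d^a x^b y^c z^e w^h.\<close>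
definition bilinear :: "nat \<Rightarrow> conn \<Rightarrow> conn \<Rightarrow> mpoly5" where
  "bilinear n m1 m2 = (\<Prod>\<gamma>\<in>curves n m1 m2. curve_class m1 m2 \<gamma>)"

text \<open>Determinant of a matrix indexed by a finite set S (Leibniz formula; independent
  of any ordering of S).\<close>
definition det_on :: "'a set \<Rightarrow> ('a \<Rightarrow> 'a \<Rightarrow> 'b::comm_ring_1) \<Rightarrow> 'b" where
  "det_on S G = (\<Sum>p | p permutes S. of_int (sign p) * (\<Prod>i\<in>S. G i (p i)))"

definition gram_det_Mb1 :: "nat \<Rightarrow> mpoly5" where
  "gram_det_Mb1 n = det_on (Mb_1 n) (bilinear n)"

end

theory Submission
  imports Defs "HOL-Library.FuncSet" Complex_Main
begin

text \<open>
  Both the Gram matrix and its kernel are described by a state sum. Write d = q + 1/q with q real,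
  and orient the curves of a gluing. The marked points become a balanced sequence of 2n signs,
  every half-turn of an arc is weighted by a square root of q, and crossing a ray to a crosscap by
  a further factor. Summing over orientations shows that, for z = u + 1/u, the block of the Gram matrix
  indexed by \<open>Mb0\<close> factors through the space of balanced sign sequences, whose dimension is
  binomial(2n, n) = card \<open>Mb0\<close>. If u is plus or minus q^k, the divided power F^(k) of quantum
  sl2 maps the sequences of weight k to the kernel of this factorization, so that the block loses rank
  binomial(2n, n-k); the map is injective because for q = 1 it is the inclusion matrix of subsets.

  An arc through the crosscap can be pushed off on either side: it then separates the two crosscaps in
  exactly one of the two cases. Hence (d + z) times a row of \<open>Mb1\<close>, restricted to the columns
  in \<open>Mb0\<close>, is x times the sum of two rows of \<open>Mb0\<close>, and these rows do not
  increase the rank unless d + z = 0. So z minus its special value divides the determinant with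
  multiplicity binomial(2n, n-k), for infinitely many real d and all real x, y, w, and division with
  remainder in z transfers this to the polynomial ring.
\<close>

section \<open>Determinants indexed by a finite set\<close>

text \<open>The rank argument is one-sided: it uses all rows but only the columns in
  \<open>Mb0\<close>. The columns in \<open>Mb1\<close> may stay arbitrary, and of the size of
  \<open>Mb0\<close> only the lower bound binomial(2n, n) enters. The kernel computation sees u only
  through u^2, so it cannot tell u = q^k from u = -q^k. The sign is decided by the rows in
  \<open>Mb1\<close>, where d + z must not vanish: u = -q would give z = -d. The choice u = -(-1)^k
  q^k makes z = u + 1/u the root of T_k(d) + (-1)^k z, and gives z = d for k = 1. Injectivity of
  F^(k) is not proved for each q separately. At q = 1 an explicit left inverse exists, and by
  continuity it remains almost a left inverse nearby. This confines q to a short interval to the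
  right of 1, which still yields infinitely many d; q > 1 also keeps the values T_k(d) distinct.
  That an oriented curve is weighted by q or 1/q, and by no other power, is a topological fact: a
  simple closed curve has turning number 1 or -1. It is proved by induction on the crossings with
  the boundary circle, cut open to a line.\<close>

lemma det_on_columns:
  "det_on S G = (\<Sum>p | p permutes S. of_int (sign p) * (\<Prod>j\<in>S. G (p j) j))"
proof (cases "finite S")
  case fin: True
  have "(\<Prod>i\<in>S. G i (p i)) = (\<Prod>j\<in>S. G (inv p j) j)" if "p permutes S" for p
  proof -
    have "(\<Prod>j\<in>S. G (inv p j) j) = (\<Prod>i\<in>S. G (inv p (p i)) (p i))"
      using prod.permute[OF that, of "\<lambda>j. G (inv p j) j"] by (simp add: o_def)
    then show ?thesis using permutes_inverses(2)[OF that] by simp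
  qed
  then have "det_on S G = (\<Sum>p | p permutes S. of_int (sign (inv p)) * (\<Prod>j\<in>S. G (inv p j) j))"
    unfolding det_on_def using fin
    by (intro sum.cong) (auto simp: sign_inverse[OF permutes_imp_permutation])
  also have "\<dots> = (\<Sum>p | p permutes S. of_int (sign p) * (\<Prod>j\<in>S. G (p j) j))"
    by (rule sum_permutations_inverse[symmetric])
  finally show ?thesis .
next
  case False
  then show ?thesis by (simp add: det_on_def)
qed

lemma det_on_column_expansion:
  assumes "finite S" "j \<in> S"
  shows "det_on S G = (\<Sum>p | p permutes S. of_int (sign p) * (G (p j) j * (\<Prod>c\<in>S - {j}. G (p c) c)))"
  unfolding det_on_columns using assms by (intro sum.cong) (auto simp: prod.remove[of S j])

lemma det_on_equal_columns:
  fixes G :: "'a \<Rightarrow> 'a \<Rightarrow> 'b::{idom,ring_char_0}"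
  assumes "finite S" "j \<in> S" "k \<in> S" "j \<noteq> k" and eq: "\<And>i. i \<in> S \<Longrightarrow> G i j = G i k"
  shows "det_on S G = 0"
proof -
  let ?t = "transpose j k"
  have t: "?t permutes S" using assms by (simp add: permutes_swap_id)
  have "(\<Prod>c\<in>S. G ((p \<circ> ?t) c) c) = (\<Prod>c\<in>S. G (p c) c)" if p: "p permutes S" for p
  proof -
    have "(\<Prod>c\<in>S. G (p c) c) = (\<Prod>c\<in>S. G (p (?t c)) (?t c))"
      using prod.permute[OF t, of "\<lambda>c. G (p c) c"] by (simp add: o_def)
    also have "\<dots> = (\<Prod>c\<in>S. G ((p \<circ> ?t) c) c)"
      using assms permutes_in_image[OF p]
      by (intro prod.cong) (auto simp: transpose_def)
    finally show ?thesis ..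
  qed
  then have "det_on S G = (\<Sum>p | p permutes S. - (of_int (sign (p \<circ> ?t)) * (\<Prod>c\<in>S. G ((p \<circ> ?t) c) c)))"
    unfolding det_on_columns using assms t
    by (intro sum.cong) (auto simp: sign_compose[OF permutes_imp_permutation permutes_imp_permutation] sign_swap_id)
  also have "\<dots> = - det_on S G"
    unfolding det_on_columns sum_negf 
    by (subst (2) sum_permutations_compose_right[OF t]) simp
  finally have "det_on S G + det_on S G = 0" by simp
  then have "2 * det_on S G = 0" by (simp only: mult_2)
  then show ?thesis by simp
qed

lemma det_on_add_multiple:
  fixes G :: "'a \<Rightarrow> 'a \<Rightarrow> 'b::{idom,ring_char_0}"
  assumes "finite S" "j \<in> S" "k \<in> S" "j \<noteq> k"
  shows "det_on S (\<lambda>i c. if c = j then G i j + r * G i k else G i c) = det_on S G"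
proof -
  let ?E = "\<lambda>f. \<Sum>p | p permutes S. of_int (sign p) * (f (p j) * (\<Prod>c\<in>S - {j}. G (p c) c))"
  have E: "det_on S (\<lambda>i c. if c = j then f i else G i c) = ?E f" for f
    by (subst det_on_column_expansion[OF assms(1,2)]) (intro sum.cong prod.cong refl arg_cong2[of _ _ _ _ "(*)"]; simp)
  have "?E (\<lambda>i. G i k) = 0"
    unfolding E[of "\<lambda>i. G i k", symmetric] by (rule det_on_equal_columns[OF assms]) (use assms in auto)
  moreover have "?E (\<lambda>i. G i j + r * G i k) = ?E (\<lambda>i. G i j) + r * ?E (\<lambda>i. G i k)"
    unfolding sum_distrib_left sum.distrib[symmetric] by (intro sum.cong) (auto simp: algebra_simps)
  moreover have "?E (\<lambda>i. G i j) = det_on S G"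
    by (rule det_on_column_expansion[OF assms(1,2), symmetric])
  ultimately show ?thesis using E by simp
qed

lemma det_on_add_multiples:
  fixes G :: "'a \<Rightarrow> 'a \<Rightarrow> 'b::{idom,ring_char_0}"
  assumes "finite S" "k \<in> S" "J \<subseteq> S - {k}"
  shows "det_on S (\<lambda>i c. if c \<in> J then G i c + r c * G i k else G i c) = det_on S G"
proof -
  have "finite J" using assms finite_subset by blast
  then show ?thesis using assms(3)
  proof (induction J)
    case (insert j J)
    let ?H = "\<lambda>i c. if c \<in> J then G i c + r c * G i k else G i c"
    have "det_on S (\<lambda>i c. if c = j then ?H i j + r j * ?H i k else ?H i c) = det_on S ?H"
      using insert assms by (intro det_on_add_multiple) auto
    moreover have "(\<lambda>i c. if c = j then ?H i j + r j * ?H i k else ?H i c)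
        = (\<lambda>i c. if c \<in> insert j J then G i c + r c * G i k else G i c)"
      using insert by (intro ext) auto
    ultimately show ?case using insert by simp
  qed simp
qed

lemma power_card_dvd_det_on:
  assumes "finite S" "F \<subseteq> S" "\<And>i j. i \<in> S \<Longrightarrow> j \<in> F \<Longrightarrow> e dvd G i j"
  shows "e ^ card F dvd det_on S G"
proof -
  have "e ^ card F dvd (\<Prod>j\<in>S. G (p j) j)" if p: "p permutes S" for p
  proof -
    have "e ^ card F = (\<Prod>j\<in>F. e)" by simp
    also have "\<dots> dvd (\<Prod>j\<in>F. G (p j) j)"
      using assms permutes_in_image[OF p] by (intro prod_dvd_prod) auto
    also have "\<dots> dvd (\<Prod>j\<in>S. G (p j) j)"
      using assms by (simp add: prod_dvd_prod_subset)
    finally show ?thesis .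
  qed
  then show ?thesis unfolding det_on_columns by (intro dvd_sum dvd_mult) auto
qed

text \<open>At \<open>c\<close> the columns in \<open>F\<close> span a space of dimension at most
  \<open>card A\<close>. An element \<open>s0\<close> of \<open>A\<close> is eliminated by column
  operations with a pivot \<open>k\<close> such that \<open>Y s0 k\<close> is nonzero, at the price
  of dropping column \<open>k\<close> from \<open>F\<close>. Once \<open>A\<close> is empty, all
  remaining columns vanish at \<open>c\<close> and each gives one linear factor.\<close>

lemma linear_power_dvd_det_on_factored:
  fixes G :: "'a \<Rightarrow> 'a \<Rightarrow> 'b::field_char_0 poly" and X :: "'a \<Rightarrow> 's \<Rightarrow> 'b"
  assumes "finite S" "finite A" "F \<subseteq> S"
    and "\<And>i j. i \<in> S \<Longrightarrow> j \<in> F \<Longrightarrow> poly (G i j) c = (\<Sum>s\<in>A. X i s * Y s j)"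
  shows "[:-c, 1:] ^ (card F - card A) dvd det_on S G"
  using assms(2-4)
proof (induction A arbitrary: F G Y)
  case empty
  then show ?case using power_card_dvd_det_on[OF assms(1) empty(1), of "[:-c,1:]" G]
    by (simp add: poly_eq_0_iff_dvd)
next
  case (insert s0 A)
  show ?case
  proof (cases "\<forall>j\<in>F. Y s0 j = 0")
    case True
    then have "[:-c, 1:] ^ (card F - card A) dvd det_on S G"
      using insert by (intro insert.IH[of F G Y]) auto
    then show ?thesis
      by (rule dvd_trans[rotated]) (use insert in \<open>auto intro!: le_imp_power_dvd\<close>)
  next
    case False
    then obtain k where k: "k \<in> F" "Y s0 k \<noteq> 0" by blast
    define r where "r j = - Y s0 j / Y s0 k" for j
    let ?H = "\<lambda>i j. if j \<in> F - {k} then G i j + [:r j:] * G i k else G i j"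
    let ?Y = "\<lambda>s j. Y s j + r j * Y s k"
    have fin: "finite F" using finite_subset[OF insert.prems(1) assms(1)] .
    have "[:-c, 1:] ^ (card (F - {k}) - card A) dvd det_on S ?H"
    proof (rule insert.IH[of "F - {k}" ?H ?Y])
      fix i j assume ij: "i \<in> S" "j \<in> F - {k}"
      have "poly (?H i j) c = (\<Sum>s\<in>insert s0 A. X i s * ?Y s j)"
      proof -
        have "poly (?H i j) c = poly (G i j) c + r j * poly (G i k) c" using ij by simp
        also have "\<dots> = (\<Sum>s\<in>insert s0 A. X i s * Y s j) + r j * (\<Sum>s\<in>insert s0 A. X i s * Y s k)"
          using ij k by (simp only: insert.prems(2) DiffD1)
        also have "\<dots> = (\<Sum>s\<in>insert s0 A. X i s * ?Y s j)"
          unfolding sum_distrib_left sum.distrib[symmetric] by (intro sum.cong) (auto simp: algebra_simps)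
        finally show ?thesis .
      qed
      also have "\<dots> = (\<Sum>s\<in>A. X i s * ?Y s j)"
        using insert.hyps k by (simp add: r_def)
      finally show "poly (?H i j) c = (\<Sum>s\<in>A. X i s * ?Y s j)" .
    qed (use insert.prems in auto)
    moreover have "det_on S ?H = det_on S G"
      using insert.prems k assms by (intro det_on_add_multiples) auto
    ultimately show ?thesis using k fin insert.hyps by (simp add: card_Diff_singleton)
  qed
qed

text \<open>Every independent vector \<open>\<psi> t\<close> killed by all rows of \<open>X\<close>
  saves one inner index of the factorization: a multiple of \<open>\<psi> t0\<close> with value 1 at
  \<open>s0\<close> expresses column \<open>s0\<close> of \<open>X\<close> through the other
  columns. So the rank drops from \<open>card A\<close> to \<open>card A - card T\<close>.\<close>

lemma linear_power_dvd_det_on: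
  fixes G :: "'a \<Rightarrow> 'a \<Rightarrow> 'b::field_char_0 poly" and X :: "'a \<Rightarrow> 's \<Rightarrow> 'b"
  assumes "finite S" "F \<subseteq> S" "finite T" "finite A"
    and "\<And>i j. i \<in> S \<Longrightarrow> j \<in> F \<Longrightarrow> poly (G i j) c = (\<Sum>s\<in>A. X i s * Y s j)"
    and "\<And>i t. i \<in> S \<Longrightarrow> t \<in> T \<Longrightarrow> (\<Sum>s\<in>A. X i s * \<psi> t s) = 0"
    and "\<And>b. (\<And>s. s \<in> A \<Longrightarrow> (\<Sum>t\<in>T. b t * \<psi> t s) = 0) \<Longrightarrow> \<forall>t\<in>T. b t = 0"
  shows "[:-c, 1:] ^ (card F + card T - card A) dvd det_on S G"
  using assms(3-7)
proof (induction T arbitrary: A Y \<psi>)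
  case empty
  then show ?case using linear_power_dvd_det_on_factored[OF assms(1) empty(1) assms(2), of G c X Y] by simp
next
  case (insert t0 T)
  note fact = insert.prems(2) and ker = insert.prems(3) and ind = insert.prems(4)
  have "\<exists>s\<in>A. \<psi> t0 s \<noteq> 0"
  proof (rule ccontr)
    assume "\<not> ?thesis"
    then have "\<forall>t\<in>insert t0 T. (if t = t0 then 1 else 0 :: 'b) = 0"
      using insert.hyps by (intro ind) (auto intro!: sum.neutral)
    then show False by simp
  qed
  then obtain s0 where s0: "s0 \<in> A" "\<psi> t0 s0 \<noteq> 0" by blast
  define \<rho> where "\<rho> s = \<psi> t0 s / \<psi> t0 s0" for s
  have rho0: "\<rho> s0 = 1" using s0 by (simp add: \<rho>_def)
  have Xrho: "(\<Sum>s\<in>A. X i s * \<rho> s) = 0" if "i \<in> S" for i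
    using ker[OF that, of t0] by (simp add: \<rho>_def sum_divide_distrib[symmetric])
  have reduce: "(\<Sum>s\<in>A. X i s * f s) = (\<Sum>s\<in>A - {s0}. X i s * (f s - \<rho> s * f s0))" if "i \<in> S" for i f
  proof -
    have "(\<Sum>s\<in>A. X i s * f s) = (\<Sum>s\<in>A. X i s * f s) - (\<Sum>s\<in>A. X i s * \<rho> s) * f s0"
      using Xrho[OF that] by simp
    also have "\<dots> = (\<Sum>s\<in>A. X i s * (f s - \<rho> s * f s0))"
      unfolding sum_distrib_right sum_subtractf[symmetric] by (intro sum.cong) (auto simp: algebra_simps)
    finally show ?thesis using s0 insert.prems(1) rho0 by (simp add: sum.remove[of A s0])
  qed
  have "[:-c, 1:] ^ (card F + card T - card (A - {s0})) dvd det_on S G"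
  proof (rule insert.IH)
    show "poly (G i j) c = (\<Sum>s\<in>A - {s0}. X i s * (Y s j - \<rho> s * Y s0 j))" if "i \<in> S" "j \<in> F" for i j
      using fact[OF that] reduce[OF that(1), of "\<lambda>s. Y s j"] by simp
    show "(\<Sum>s\<in>A - {s0}. X i s * (\<psi> t s - \<rho> s * \<psi> t s0)) = 0" if "i \<in> S" "t \<in> T" for i t
      using ker[OF that(1)] that reduce[OF that(1), of "\<psi> t"] by simp
    fix b assume b: "\<And>s. s \<in> A - {s0} \<Longrightarrow> (\<Sum>t\<in>T. b t * (\<psi> t s - \<rho> s * \<psi> t s0)) = 0"
    \<comment> \<open>A relation among the reduced vectors lifts to one among the original vectors:
      the coefficient of \<open>t0\<close> is chosen so that the coordinate \<open>s0\<close>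
      cancels.\<close>
    define B where "B = (\<Sum>t\<in>T. b t * \<psi> t s0)"
    define b' where "b' = b(t0 := - B / \<psi> t0 s0)"
    have "(\<Sum>t\<in>T. b t * \<psi> t s) = \<rho> s * B" if "s \<in> A" for s
    proof (cases "s = s0")
      case True then show ?thesis by (simp add: rho0 B_def)
    next
      case False
      then have "(\<Sum>t\<in>T. b t * (\<psi> t s - \<rho> s * \<psi> t s0)) = 0" using b that by simp
      moreover have "(\<Sum>t\<in>T. b t * (\<psi> t s - \<rho> s * \<psi> t s0)) = (\<Sum>t\<in>T. b t * \<psi> t s) - \<rho> s * B"
        unfolding B_def sum_distrib_left sum_subtractf[symmetric] by (intro sum.cong) (auto simp: algebra_simps)
      ultimately show ?thesis by simp
    qed
    moreover have "(\<Sum>t\<in>insert t0 T. b' t * \<psi> t s) = - B * \<rho> s + (\<Sum>t\<in>T. b t * \<psi> t s)" for s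
    proof -
      have "(\<Sum>t\<in>T. b' t * \<psi> t s) = (\<Sum>t\<in>T. b t * \<psi> t s)"
        using insert.hyps by (intro sum.cong) (auto simp: b'_def)
      then show ?thesis using insert.hyps by (simp add: b'_def \<rho>_def)
    qed
    ultimately have "\<forall>t\<in>insert t0 T. b' t = 0" by (intro ind) simp
    then show "\<forall>t\<in>T. b t = 0" using insert.hyps by (auto simp: b'_def split: if_splits)
  qed (use insert.prems in auto)
  \<comment> \<open>The subtraction in the exponent is truncated; since \<open>A\<close> is
    nonempty, removing \<open>s0\<close> from \<open>A\<close> has the same effect on it as adding
    \<open>t0\<close> to \<open>T\<close>.\<close>
  moreover have "card A > 0" using s0 insert.prems(1) by (auto simp: card_gt_0_iff)
  ultimately show ?case using s0 insert.hyps insert.prems(1) by (simp add: card_Diff_singleton)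
qed

section \<open>Evaluation of polynomials in five variables\<close>

locale unital_ring_hom =
  fixes h :: "'a::comm_ring_1 \<Rightarrow> 'b::comm_ring_1"
  assumes hom_one: "h 1 = 1"
    and hom_add: "h (a + b) = h a + h b"
    and hom_mult: "h (a * b) = h a * h b"
begin

lemma hom_zero: "h 0 = 0"
  using hom_add[of 0 0] by simp

lemma hom_uminus: "h (- a) = - h a"
  using hom_add[of a "- a"] by (simp add: hom_zero eq_neg_iff_add_eq_0 add.commute)

lemma hom_diff: "h (a - b) = h a - h b"
  using hom_add[of a "- b"] by (simp add: hom_uminus)

lemma hom_sum: "h (sum f A) = (\<Sum>i\<in>A. h (f i))"
  by (induction A rule: infinite_finite_induct) (simp_all add: hom_zero hom_add)

lemma hom_prod: "h (prod f A) = (\<Prod>i\<in>A. h (f i))"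
  by (induction A rule: infinite_finite_induct) (simp_all add: hom_one hom_mult)

lemma hom_power: "h (a ^ k) = h a ^ k"
  by (induction k) (simp_all add: hom_one hom_mult)

lemma hom_of_nat: "h (of_nat k) = of_nat k"
  by (induction k) (simp_all add: hom_zero hom_one hom_add)

lemma hom_of_int: "h (of_int k) = of_int k"
  by (cases k) (simp_all add: hom_of_nat hom_uminus hom_diff hom_one)

lemma hom_det_on: "h (det_on S G) = det_on S (\<lambda>i j. h (G i j))"
  by (simp add: det_on_def hom_sum hom_mult hom_of_int hom_prod)

lemma map_poly_hom: "unital_ring_hom (map_poly h)"
proof
  show "map_poly h 1 = 1" by (simp add: hom_one)
  show "map_poly h (p + q) = map_poly h p + map_poly h q" for p q
    by (intro poly_eqI) (simp add: coeff_map_poly hom_zero hom_add)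
  show "map_poly h (p * q) = map_poly h p * map_poly h q" for p q
    by (intro poly_eqI) (simp add: coeff_map_poly hom_zero coeff_mult hom_sum hom_mult)
qed

lemma eval_hom: "unital_ring_hom (\<lambda>p. poly (map_poly h p) a)"
proof -
  interpret m: unital_ring_hom "map_poly h" by (rule map_poly_hom)
  show ?thesis by unfold_locales (simp_all add: m.hom_one m.hom_add m.hom_mult)
qed

end

lemma unital_ring_hom_of_int: "unital_ring_hom (of_int :: int \<Rightarrow> 'a::comm_ring_1)"
  by unfold_locales simp_all

text \<open>Pseudo-division first scales \<open>f\<close> by a power of the leading coefficient, and
  a power of its inverse \<open>u\<close> undoes this. Bounding the coefficients of \<open>r\<close>
  instead of its degree covers \<open>r = 0\<close> together with
  \<open>degree g = 0\<close>.\<close>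

lemma unit_lead_coeff_division:
  fixes f g :: "'a::idom poly"
  assumes "lead_coeff g dvd 1"
  shows "\<exists>q r. f = g * q + r \<and> (\<forall>m\<ge>degree g. coeff r m = 0)"
proof -
  have g: "g \<noteq> 0" using assms by auto
  obtain u where u: "lead_coeff g * u = 1" using assms by (metis dvdE)
  obtain q r where qr: "pseudo_divmod f g = (q, r)" by fastforce
  define l where "l = Suc (degree f) - degree g"
  have 1: "smult (lead_coeff g ^ l) f = g * q + r" and 2: "r = 0 \<or> degree r < degree g"
    using pseudo_divmod[OF g qr] by (simp_all add: l_def)
  have "f = smult (u ^ l) (smult (lead_coeff g ^ l) f)"
    using u by (simp add: power_mult_distrib[symmetric] mult.commute)
  also have "\<dots> = g * smult (u ^ l) q + smult (u ^ l) r"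
    by (simp add: 1 smult_add_right)
  finally show ?thesis using 2 by (intro exI[of _ "smult (u ^ l) q"] exI[of _ "smult (u ^ l) r"])
      (auto simp: coeff_eq_0)
qed

text \<open>This adjoins one variable to a separating family: a specialization that keeps the
  leading coefficient alive leaves a nonzero polynomial, and its finitely many roots cannot exhaust
  \<open>A\<close>.\<close>

lemma separating_evaluation:
  fixes h :: "'t \<Rightarrow> 'a::zero \<Rightarrow> 'b::idom"
  assumes "\<And>c. c \<noteq> 0 \<Longrightarrow> \<exists>\<theta>\<in>\<Theta>. h \<theta> c \<noteq> 0" "\<And>\<theta>. h \<theta> 0 = 0" "infinite A" "p \<noteq> 0"
  shows "\<exists>\<theta>\<in>\<Theta>. \<exists>a\<in>A. poly (map_poly (h \<theta>) p) a \<noteq> 0"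
proof -
  obtain \<theta> where \<theta>: "\<theta> \<in> \<Theta>" "h \<theta> (lead_coeff p) \<noteq> 0"
    using assms(1)[of "lead_coeff p"] assms(4) by auto
  then have "map_poly (h \<theta>) p \<noteq> 0"
    using assms(2) by (metis coeff_0 coeff_map_poly)
  then have "finite {a. poly (map_poly (h \<theta>) p) a = 0}" by (rule poly_roots_finite)
  then show ?thesis using assms(3) \<theta> by (metis (mono_tags, lifting) finite_subset mem_Collect_eq subsetI)
qed

definition ev_d :: "real \<Rightarrow> int poly \<Rightarrow> real"
  where "ev_d d p = poly (map_poly of_int p) d"
definition ev_dx :: "real \<Rightarrow> real \<Rightarrow> int poly poly \<Rightarrow> real"
  where "ev_dx d x p = poly (map_poly (ev_d d) p) x"
definition ev_dxy :: "real \<Rightarrow> real \<Rightarrow> real \<Rightarrow> int poly poly poly \<Rightarrow> real"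
  where "ev_dxy d x y p = poly (map_poly (ev_dx d x) p) y"
text \<open>\<open>w\<close> is the outermost variable and \<open>z\<close> the next one, so
  \<open>w\<close> becomes a constant polynomial and what remains is a real polynomial in
  \<open>z\<close>, for which multiplicities of roots make sense.\<close>

definition ev :: "real \<Rightarrow> real \<Rightarrow> real \<Rightarrow> real \<Rightarrow> mpoly5 \<Rightarrow> real poly"
  where "ev d x y w p = poly (map_poly (map_poly (ev_dxy d x y)) p) [:w:]"

interpretation ev_d: unital_ring_hom "ev_d d" for d
  unfolding ev_d_def[abs_def] by (rule unital_ring_hom.eval_hom[OF unital_ring_hom_of_int])
interpretation ev_dx: unital_ring_hom "ev_dx d x" for d x
  unfolding ev_dx_def[abs_def] by (rule ev_d.eval_hom)
interpretation ev_dxy: unital_ring_hom "ev_dxy d x y" for d x y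
  unfolding ev_dxy_def[abs_def] by (rule ev_dx.eval_hom)
interpretation ev: unital_ring_hom "ev d x y w" for d x y w
  unfolding ev_def[abs_def] by (rule unital_ring_hom.eval_hom[OF ev_dxy.map_poly_hom])

lemma ev_var [simp]:
  "ev d x y w var_d = [:d:]" "ev d x y w var_x = [:x:]" "ev d x y w var_y = [:y:]"
  "ev d x y w var_z = [:0, 1:]" "ev d x y w var_w = [:w:]"
  by (simp_all add: ev_def var_d_def var_x_def var_y_def var_z_def var_w_def map_poly_pCons
      ev_d.hom_zero ev_d.hom_one ev_dx.hom_zero ev_dx.hom_one ev_dxy.hom_zero ev_dxy.hom_one
      ev_dxy_def ev_dx_def ev_d_def)

lemma ev_separating:
  assumes D: "infinite D" and p: "p \<noteq> 0"
  shows "\<exists>d\<in>D. \<exists>x y w. ev d x y w p \<noteq> 0"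
proof -
  have R: "infinite (UNIV :: real set)" by (rule infinite_UNIV_char_0)
  have 1: "\<exists>d\<in>D. ev_d d c \<noteq> 0" if "c \<noteq> 0" for c
    using separating_evaluation[of "UNIV :: unit set" "\<lambda>_. of_int :: int \<Rightarrow> real" D c] D that
    by (auto simp: ev_d_def)
  have 2: "\<exists>(d, x)\<in>D \<times> UNIV. ev_dx d x c \<noteq> 0" if "c \<noteq> 0" for c
    using separating_evaluation[of D ev_d UNIV c] 1 R that
    by (auto simp: ev_dx_def ev_d.hom_zero)
  have 3: "\<exists>(d, x, y)\<in>D \<times> UNIV \<times> UNIV. ev_dxy d x y c \<noteq> 0" if "c \<noteq> 0" for c
  proof -
    have "\<exists>\<theta>\<in>D \<times> UNIV. \<exists>y\<in>UNIV. poly (map_poly ((\<lambda>(d, x). ev_dx d x) \<theta>) c) y \<noteq> 0"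
      by (rule separating_evaluation) (use 2 R that in \<open>auto simp: ev_dx.hom_zero case_prod_beta\<close>)
    then show ?thesis by (auto simp: ev_dxy_def)
  qed
  have 4: "\<exists>(d, x, y)\<in>D \<times> UNIV \<times> UNIV. map_poly (ev_dxy d x y) c \<noteq> 0" if "c \<noteq> 0" for c
  proof -
    obtain d x y where "d \<in> D" "ev_dxy d x y (lead_coeff c) \<noteq> 0"
      using 3[of "lead_coeff c"] \<open>c \<noteq> 0\<close> by auto
    then have "coeff (map_poly (ev_dxy d x y) c) (degree c) \<noteq> 0"
      by (simp add: coeff_map_poly ev_dxy.hom_zero)
    then have "map_poly (ev_dxy d x y) c \<noteq> 0" by (metis coeff_0)
    then show ?thesis using \<open>d \<in> D\<close> by (intro bexI[of _ "(d, x, y)"]) auto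
  qed
  have W: "infinite (range (\<lambda>w::real. [:w:]))"
    using R finite_imageD[of "\<lambda>w::real. [:w:]" UNIV] by (auto simp: inj_on_def)
  have "\<exists>\<theta>\<in>D \<times> UNIV \<times> UNIV. \<exists>a\<in>range (\<lambda>w. [:w:]).
      poly (map_poly ((\<lambda>(d, x, y). map_poly (ev_dxy d x y)) \<theta>) p) a \<noteq> 0"
    by (rule separating_evaluation) (use 4 W p in \<open>auto simp: case_prod_beta\<close>)
  then show ?thesis by (auto simp: ev_def)
qed

text \<open>The remainder of a division by Q in the variable z has z-degree smaller than Q, so
  all its evaluations vanish.\<close>
lemma dvd_if_dvd_evaluations:
  fixes Q :: "int poly poly poly poly"
  assumes lc: "lead_coeff Q dvd 1" and D: "infinite D"
    and dvd: "\<And>d x y w. d \<in> D \<Longrightarrow> ev d x y w [:Q:] dvd ev d x y w P"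
  shows "[:Q:] dvd P"
proof -
  \<comment> \<open>The clause for \<open>c = 0\<close> is there because quotient and remainder are
    formed coefficientwise with \<open>map_poly\<close>, which behaves well only for functions
    fixing 0.\<close>
  have "\<exists>q r. c = Q * q + r \<and> (\<forall>m\<ge>degree Q. coeff r m = 0) \<and> (c = 0 \<longrightarrow> q = 0 \<and> r = 0)" for c
    using unit_lead_coeff_division[OF lc, of c] by (cases "c = 0") (auto intro: exI[of _ 0])
  then obtain q r where qr: "\<And>c. c = Q * q c + r c" "\<And>c m. m \<ge> degree Q \<Longrightarrow> coeff (r c) m = 0"
    and q0: "q 0 = 0" and r0: "r 0 = 0" by metis
  define R where "R = map_poly r P"
  have P: "P = [:Q:] * map_poly q P + R"
  proof (rule poly_eqI)
    fix i
    show "coeff P i = coeff ([:Q:] * map_poly q P + R) i"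
      using qr(1)[of "coeff P i"] by (simp add: R_def coeff_map_poly q0 r0)
  qed
  have evP: "ev d x y w P = ev d x y w [:Q:] * ev d x y w (map_poly q P) + ev d x y w R" for d x y w
    by (subst P) (simp only: ev.hom_add ev.hom_mult)
  have "ev d x y w R = 0" if d: "d \<in> D" for d x y w
  proof (rule ccontr)
    let ?e = "map_poly (ev_dxy d x y)"
    assume nz: "ev d x y w R \<noteq> 0"
    have coeff0: "coeff (ev d x y w R) m = 0" if "m \<ge> degree Q" for m
    proof -
      have "coeff (?e (coeff R i) * [:w:] ^ i) m = 0" for i
        using qr(2)[OF that]
        by (simp add: R_def poly_const_pow coeff_map_poly r0 ev_dxy.hom_zero)
      then show ?thesis by (simp add: ev_def poly_altdef coeff_sum coeff_map_poly ev_dxy.hom_zero)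
    qed
    have evQ: "ev d x y w [:Q:] = ?e Q" by (simp add: ev_def map_poly_pCons ev_dxy.hom_zero)
    \<comment> \<open>A unit stays nonzero under evaluation, so the degree of \<open>Q\<close> in
      \<open>z\<close> does not drop.\<close>
    obtain u where "lead_coeff Q * u = 1" using lc by (metis dvdE)
    then have "ev_dxy d x y (lead_coeff Q) \<noteq> 0"
      by (metis ev_dxy.hom_mult ev_dxy.hom_one mult_zero_left zero_neq_one)
    then have "degree Q \<le> degree (?e Q)"
      by (intro le_degree) (simp add: coeff_map_poly ev_dxy.hom_zero)
    moreover have "?e Q dvd ev d x y w R"
      using dvd[OF d, of x y w] unfolding evP evQ by (simp add: dvd_add_right_iff)
    ultimately have "degree Q \<le> degree (ev d x y w R)"
      using dvd_imp_degree_le[OF _ nz] order_trans by blast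
    then have "lead_coeff (ev d x y w R) = 0" by (rule coeff0)
    then show False using nz by simp
  qed
  then have "R = 0" using ev_separating[OF D] by blast
  then have "P = [:Q:] * map_poly q P" using P by simp
  then show ?thesis by (rule dvdI)
qed

section \<open>Noncrossing involutions and the turning number of a meander\<close>

text \<open>\<open>(p < r) = (f p < r)\<close> says that \<open>r\<close> is not beneath the arc
  joining \<open>p\<close> and \<open>f p\<close>, without fixing which end is the left one. The set
  \<open>X\<close> is arbitrary because single curves are subsets of the marked points and the
  inductions delete points.\<close>

definition nc_involution :: "nat set \<Rightarrow> (nat \<Rightarrow> nat) \<Rightarrow> bool" where
  "nc_involution X f \<longleftrightarrow> (\<forall>p\<in>X. f p \<in> X \<and> f p \<noteq> p \<and> f (f p) = p) \<and>
     (\<forall>p\<in>X. \<forall>r\<in>X. r \<noteq> p \<longrightarrow> r \<noteq> f p \<longrightarrow>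
        ((p < r) = (f p < r)) = ((p < f r) = (f p < f r)))"

lemma nc_involutionD:
  assumes "nc_involution X f" "p \<in> X"
  shows "f p \<in> X" "f p \<noteq> p" "f (f p) = p"
    "\<And>r. r \<in> X \<Longrightarrow> r \<noteq> p \<Longrightarrow> r \<noteq> f p \<Longrightarrow> ((p < r) = (f p < r)) = ((p < f r) = (f p < f r))"
  using assms unfolding nc_involution_def by blast+

lemma even_card_involution:
  assumes "finite Y" "\<And>v. v \<in> Y \<Longrightarrow> f v \<in> Y \<and> f v \<noteq> v \<and> f (f v) = v"
  shows "even (card Y)"
  using assms
proof (induction "card Y" arbitrary: Y rule: less_induct)
  case less
  show ?case
  proof (cases "Y = {}")
    case False
    then obtain v where v: "v \<in> Y" by blast
    let ?Z = "Y - {v, f v}"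
    have sub: "{v, f v} \<subseteq> Y" and c2: "card {v, f v} = 2" using less.prems(2)[OF v] v by auto
    have c: "card Y = card ?Z + 2"
      using card_Diff_subset[of "{v, f v}" Y] card_mono[OF less.prems(1) sub] sub c2 by simp
    have "f w \<in> ?Z" if "w \<in> ?Z" for w
      using less.prems(2)[of w] less.prems(2)[OF v] that by auto
    then have "even (card ?Z)"
      using less.hyps[of ?Z] less.prems c by auto
    then show ?thesis using c by simp
  qed simp
qed

lemma sum_antisymmetric_involution:
  fixes s :: "'a \<Rightarrow> int"
  assumes "\<And>v. v \<in> Y \<Longrightarrow> f v \<in> Y \<and> f (f v) = v \<and> s (f v) = - s v"
  shows "(\<Sum>v\<in>Y. s v) = 0"
proof -
  have "(\<Sum>v\<in>Y. s v) = (\<Sum>v\<in>Y. s (f v))"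
    by (rule sum.reindex_bij_witness[of _ f f]) (use assms in auto)
  also have "\<dots> = - (\<Sum>v\<in>Y. s v)" using assms by (simp add: sum_negf)
  finally show ?thesis by simp
qed

lemma between_closed:
  assumes f: "nc_involution X f" and p: "p \<in> X" and v: "v \<in> X" "p < v" "v < f p"
  shows "p < f v" "f v < f p"
  using nc_involutionD[OF f p] nc_involutionD[OF f v(1)] v
  by (smt (verit) nat_neq_iff order_less_trans)+

lemma even_between:
  assumes f: "nc_involution X f" and p: "p \<in> X" and Z: "finite Z" "Z \<subseteq> X" "f ` Z \<subseteq> Z"
  shows "even (card {v \<in> Z. p < v \<and> v < f p})"
proof (rule even_card_involution[of _ f])
  fix v assume "v \<in> {v \<in> Z. p < v \<and> v < f p}"
  then show "f v \<in> {v \<in> Z. p < v \<and> v < f p} \<and> f v \<noteq> v \<and> f (f v) = v"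
    using Z between_closed[OF f p, of v] nc_involutionD[OF f, of v] by auto
qed (use Z in auto)

text \<open>A single closed curve crosses the line alternately upwards and downwards, in the order
  of the points on the line. This is its orientation with the leftmost crossing positive.\<close>

definition alt_sign :: "nat set \<Rightarrow> nat \<Rightarrow> int" where
  "alt_sign X v = (if even (card {x \<in> X. x < v}) then 1 else -1)"

definition arc_dir :: "(nat \<Rightarrow> nat) \<Rightarrow> nat \<Rightarrow> int" where
  "arc_dir f v = (if v < f v then 1 else -1)"

lemma alt_sign_partner:
  assumes f: "nc_involution X f" and X: "finite X" and p: "p \<in> X"
  shows "alt_sign X (f p) = - alt_sign X p"
proof -
  have *: "alt_sign X (f p) = - alt_sign X p" if p: "p \<in> X" "p < f p" for p
  proof -
    have "{x \<in> X. x < f p} = insert p ({x \<in> X. x < p} \<union> {v \<in> X. p < v \<and> v < f p})"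
      using p by auto
    moreover have "card \<dots> = Suc (card {x \<in> X. x < p} + card {v \<in> X. p < v \<and> v < f p})"
      using X by (subst card_insert_disjoint) (auto intro!: card_Un_disjoint)
    moreover have "even (card {v \<in> X. p < v \<and> v < f p})"
      using even_between[OF f p(1) X] nc_involutionD[OF f] by auto
    ultimately show ?thesis by (simp add: alt_sign_def)
  qed
  show ?thesis
    using *[of p] *[of "f p"] nc_involutionD[OF f p] p by (metis nat_neq_iff minus_minus)
qed

text \<open>Turning number one, counted in half-turns at both ends of each arc. In the induction an
  innermost upper arc joining p to p' is pushed across the line, which merges the two lower arcs
  ending in p and p'.\<close>
lemma turning_number:
  assumes "finite X" "X \<noteq> {}" "nc_involution X f" "nc_involution X g"
    and "\<And>Y. Y \<subseteq> X \<Longrightarrow> Y \<noteq> {} \<Longrightarrow> (\<And>v. v \<in> Y \<Longrightarrow> f v \<in> Y \<and> g v \<in> Y) \<Longrightarrow> Y = X"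
  shows "(\<Sum>v\<in>X. alt_sign X v * arc_dir f v) + (\<Sum>v\<in>X. alt_sign X v * arc_dir g v) = 4"
  using assms
proof (induction "card X" arbitrary: X g rule: less_induct)
  case less
  note fin = less.prems(1) and f = less.prems(3) and g = less.prems(4) and conn = less.prems(5)
  note fD = nc_involutionD[OF f] and gD = nc_involutionD[OF g]
  have "\<exists>p. p \<in> X \<and> p < f p"
    using less.prems(2) fD by (metis all_not_in_conv nat_neq_iff)
  then have "\<exists>p. (p \<in> X \<and> p < f p) \<and> (\<forall>q. q \<in> X \<and> q < f q \<longrightarrow> f p - p \<le> f q - q)"
    by (elim exE, intro ex_has_least_nat)
  then obtain p where p: "p \<in> X" "p < f p"
    and min: "\<And>q. q \<in> X \<Longrightarrow> q < f q \<Longrightarrow> f p - p \<le> f q - q"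
    by blast
  define p' where "p' = f p"
  have p': "p' \<in> X" "p < p'" "f p' = p" using p fD(1,3)[OF p(1)] by (auto simp: p'_def)
  have adj: "\<not> (p < v \<and> v < p')" if v: "v \<in> X" for v
  proof
    assume b: "p < v \<and> v < p'"
    then have b': "p < f v" "f v < p'"
      using between_closed[OF f p(1) v] by (auto simp: p'_def)
    show False
    proof (cases "v < f v")
      case True
      then have "p' - p \<le> f v - v" using min[OF v] by (simp add: p'_def)
      then show False using b b' True by linarith
    next
      case False
      then have "f v < v" using fD(2)[OF v] by linarith
      then have "p' - p \<le> v - f v" using min[OF fD(1)[OF v]] fD(3)[OF v] by (simp add: p'_def)
      then show False using b b' \<open>f v < v\<close> by linarith
    qed
  qed
  show ?case
  proof (cases "g p = p'")
    case True
    then have "g p' = p" using gD(3)[OF p(1)] by simp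
    then have X: "X = {p, p'}" using conn[of "{p, p'}"] p p' True p'_def by auto
    have "{x \<in> X. x < p} = {}" "{x \<in> X. x < p'} = {p}" using X p' by auto
    then have "alt_sign X p = 1" "alt_sign X p' = -1" unfolding alt_sign_def by (metis even_zero card.empty, metis One_nat_def card_1_singleton_iff odd_one)
    then show ?thesis using X p' True \<open>g p' = p\<close> p'_def[symmetric] by (simp add: arc_dir_def)
  next
    case False
    define a b where "a = g p" and "b = g p'"
    have a: "a \<in> X" "a \<noteq> p" "a \<noteq> p'" "g a = p" using False gD[OF p(1)] by (auto simp: a_def)
    have b: "b \<in> X" "b \<noteq> p" "b \<noteq> p'" "g b = p'" using False gD[OF p'(1)] by (auto simp: b_def)
    have ab: "a \<noteq> b" using a b p' by auto
    define X' where "X' = X - {p, p'}"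
    define g' where "g' = g(a := b, b := a)"
    have g'v: "g' v = g v" if "v \<noteq> a" "v \<noteq> b" for v using that by (simp add: g'_def)
    have g'ab: "g' a = b" "g' b = a" using ab by (auto simp: g'_def)
    have gX': "g v \<in> X'" if "v \<in> X'" "v \<noteq> a" "v \<noteq> b" for v
      using that gD[of v] by (auto simp: X'_def a_def b_def)
    have fX': "f v \<in> X'" if "v \<in> X'" for v
      using that fD[of v] p' by (auto simp: X'_def p'_def)
    have abX': "a \<in> X'" "b \<in> X'" using a b by (auto simp: X'_def)
    have f': "nc_involution X' f"
      unfolding nc_involution_def using fX' fD by (auto simp: X'_def)
    have gne: "g v \<noteq> a" "g v \<noteq> b" if "v \<in> X'" for v
      using that gD(3)[of v] a b by (auto simp: X'_def)
    have inv: "g' v \<in> X' \<and> g' v \<noteq> v \<and> g' (g' v) = v" if v: "v \<in> X'" for v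
    proof -
      have "v \<in> X" using v by (simp add: X'_def)
      then show ?thesis
        using gX'[OF v] abX' g'v ab g'ab gne[OF v] gD[of v]
        by (cases "v = a"; cases "v = b") auto
    qed
    have ncab: "((a < r) = (b < r)) = ((a < g r) = (b < g r))" if r: "r \<in> X'" "r \<noteq> a" "r \<noteq> b" for r
    proof -
      have rX: "r \<in> X" "g r \<in> X" and rp: "r \<noteq> p" "r \<noteq> p'" using r gX'[OF r] by (auto simp: X'_def)
      have "(p < r) = (p' < r)" "(p < g r) = (p' < g r)"
        using adj[OF rX(1)] adj[OF rX(2)] p'(2) rp gX'[OF r] by (auto simp: X'_def)
      moreover have "((p < r) = (a < r)) = ((p < g r) = (a < g r))"
        using gD(4)[OF p(1) rX(1)] rp r by (simp add: a_def)
      moreover have "((p' < r) = (b < r)) = ((p' < g r) = (b < g r))"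
        using gD(4)[OF p'(1) rX(1)] rp r by (simp add: b_def)
      ultimately show ?thesis by argo
    qed
    have g': "nc_involution X' g'"
      unfolding nc_involution_def
    proof (intro conjI ballI impI)
      fix u r assume u: "u \<in> X'" and r: "r \<in> X'" and ne: "r \<noteq> u" "r \<noteq> g' u"
      have X: "u \<in> X" "r \<in> X" using u r by (auto simp: X'_def)
      consider "u \<in> {a, b}" | "u \<notin> {a, b}" "r \<in> {a, b}" | "u \<notin> {a, b}" "r \<notin> {a, b}" by blast
      then show "((u < r) = (g' u < r)) = ((u < g' r) = (g' u < g' r))"
      proof cases
        case 1
        then have "r \<notin> {a, b}" using ne g'ab by auto
        then show ?thesis using 1 ncab[OF r] g'ab g'v[of r] by auto
      next
        case 2
        have "a \<noteq> u" "a \<noteq> g u" "b \<noteq> u" "b \<noteq> g u" using 2 gne[OF u] by auto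
        moreover have "a \<notin> {p,p'}" "b \<notin> {p,p'}" using a b by auto
        ultimately have "((a < u) = (b < u)) = ((a < g u) = (b < g u))" using ncab[OF u] by auto
        then show ?thesis
          using 2 g'ab g'v[of u] \<open>a \<noteq> u\<close> \<open>a \<noteq> g u\<close> \<open>b \<noteq> u\<close> \<open>b \<noteq> g u\<close>
          by (auto simp: not_less_iff_gr_or_eq)
      next
        case 3
        then show ?thesis using gD(4)[OF X] ne g'v by auto
      qed
    qed (use inv in auto)
    have altX': "alt_sign X' v = alt_sign X v" if "v \<in> X'" for v
    proof (cases "p < v")
      case True
      then have "p' < v" using adj that by (force simp: X'_def)
      then have "{x \<in> X. x < v} = insert p (insert p' {x \<in> X'. x < v})"
        using True p p' by (auto simp: X'_def)
      moreover have "p \<notin> insert p' {x \<in> X'. x < v}" "p' \<notin> {x \<in> X'. x < v}"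
        using p' by (auto simp: X'_def)
      ultimately have "card {x \<in> X. x < v} = Suc (Suc (card {x \<in> X'. x < v}))"
        using fin by (simp add: X'_def)
      then show ?thesis by (simp add: alt_sign_def)
    next
      case False
      then have "{x \<in> X'. x < v} = {x \<in> X. x < v}" using p' by (auto simp: X'_def)
      then show ?thesis by (simp add: alt_sign_def)
    qed
    have conn': "Y = X'" if Y: "Y \<subseteq> X'" "Y \<noteq> {}" and cl: "\<And>v. v \<in> Y \<Longrightarrow> f v \<in> Y \<and> g' v \<in> Y" for Y
    proof -
      have abY: "a \<in> Y \<longleftrightarrow> b \<in> Y" using cl g'ab by metis
      have gv: "g v \<in> Y" if "v \<in> Y" "v \<noteq> a" "v \<noteq> b" for v using cl[OF that(1)] g'v that by simp
      have "(if a \<in> Y then Y \<union> {p, p'} else Y) = X"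
      proof (rule conn)
        fix v assume "v \<in> (if a \<in> Y then Y \<union> {p, p'} else Y)"
        then show "f v \<in> (if a \<in> Y then Y \<union> {p, p'} else Y) \<and> g v \<in> (if a \<in> Y then Y \<union> {p, p'} else Y)"
          using abY gv cl p' a b a_def b_def p'_def by (auto split: if_splits)
      qed (use Y p p' in \<open>auto simp: X'_def split: if_splits\<close>)
      then show ?thesis using Y by (auto simp: X'_def split: if_splits)
    qed
    have "card X' < card X" using fin p by (auto simp: X'_def intro!: psubset_card_mono)
    then have IH: "(\<Sum>v\<in>X'. alt_sign X' v * arc_dir f v) + (\<Sum>v\<in>X'. alt_sign X' v * arc_dir g' v) = 4"
      using less.hyps[of X' g'] fin abX' f' g' conn' by (auto simp: X'_def)
    have XX': "X = insert p (insert p' X')" "p \<notin> insert p' X'" "p' \<notin> X'" "finite X'"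
      using p p' fin by (auto simp: X'_def)
    define X'' where "X'' = X' - {a, b}"
    have XX'': "X' = insert a (insert b X'')" "a \<notin> insert b X''" "b \<notin> X''" "finite X''"
      using abX' ab XX' by (auto simp: X''_def)
    define \<epsilon> where "\<epsilon> = alt_sign X p"
    have eps: "alt_sign X p' = - \<epsilon>" "alt_sign X a = - \<epsilon>" "alt_sign X b = \<epsilon>"
      using alt_sign_partner[OF f fin p(1)] alt_sign_partner[OF g fin p(1)] alt_sign_partner[OF g fin p'(1)]
      by (auto simp: \<epsilon>_def p'_def a_def b_def)
    have arc_dir'': "arc_dir g' v = arc_dir g v" if "v \<in> X''" for v
      using that g'v[of v] by (simp add: X''_def arc_dir_def)
    have sumX: "sum F X = F p + F p' + sum F X'" for F :: "nat \<Rightarrow> int"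
      by (subst XX'(1)) (use XX'(2-) in simp)
    have sumX': "sum F X' = F a + F b + sum F X''" for F :: "nat \<Rightarrow> int"
      by (subst XX''(1)) (use XX''(2-) in simp)
    have 1: "(\<Sum>v\<in>X. alt_sign X v * arc_dir f v) = 2 * \<epsilon> + (\<Sum>v\<in>X'. alt_sign X v * arc_dir f v)"
      unfolding sumX eps using p' p'_def[symmetric] by (simp add: arc_dir_def \<epsilon>_def[symmetric])
    have 2: "(\<Sum>v\<in>X. alt_sign X v * arc_dir g v) = \<epsilon> * arc_dir g p - \<epsilon> * arc_dir g p' - \<epsilon> * arc_dir g a + \<epsilon> * arc_dir g b
        + (\<Sum>v\<in>X''. alt_sign X v * arc_dir g v)"
      unfolding sumX sumX' eps by (simp add: \<epsilon>_def[symmetric])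
    have 3: "(\<Sum>v\<in>X'. alt_sign X v * arc_dir g' v) = \<epsilon> * arc_dir g' b - \<epsilon> * arc_dir g' a + (\<Sum>v\<in>X''. alt_sign X v * arc_dir g v)"
      unfolding sumX' eps using arc_dir'' by simp
    \<comment> \<open>\<open>p\<close> and \<open>p'\<close> are neighbours, so \<open>a\<close> and
      \<open>b\<close> compare alike with both. Noncrossing of \<open>g\<close> leaves only those
      orders of \<open>p\<close>, \<open>a\<close>, \<open>b\<close> in which the half-turn of the
      deleted upper arc makes up for merging the two lower arcs.\<close>
    have "2 + arc_dir g p - arc_dir g p' - arc_dir g a + arc_dir g b = arc_dir g' b - arc_dir g' a"
    proof -
      have "((p < p') = (a < p')) = ((p < b) = (a < b))"
        using gD(4)[OF p(1) p'(1)] p'(2) a by (simp add: a_def b_def)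
      moreover have "(p' < b) = (p < b)" "(p' < a) = (p < a)"
        using adj[OF b(1)] adj[OF a(1)] p'(2) a b by auto
      ultimately show ?thesis using p'(2) a(2,3) b(2,3) ab
        unfolding arc_dir_def a_def[symmetric] b_def[symmetric] a(4) b(4) g'ab
        by (cases "p < a"; cases "p < b"; cases "a < b") auto
    qed
    then have "\<epsilon> * (2 + arc_dir g p - arc_dir g p' - arc_dir g a + arc_dir g b) = \<epsilon> * (arc_dir g' b - arc_dir g' a)" by simp
    then have "2 * \<epsilon> + (\<epsilon> * arc_dir g p - \<epsilon> * arc_dir g p' - \<epsilon> * arc_dir g a + \<epsilon> * arc_dir g b) = \<epsilon> * arc_dir g' b - \<epsilon> * arc_dir g' a"
      by (simp add: algebra_simps)
    then show ?thesis using IH 1 2 3 altX' by simp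
  qed
qed

section \<open>Noncrossing matchings from balanced subsets\<close>

lemma nc_involution_insert:
  assumes f: "nc_involution X f" and pq: "p \<notin> X" "q \<notin> X" "p \<noteq> q"
    and nc: "\<And>r. r \<in> X \<Longrightarrow> ((p < r) = (q < r)) = ((p < f r) = (q < f r))"
  shows "nc_involution (insert p (insert q X)) (f(p := q, q := p))" (is "nc_involution ?X ?f")
proof -
  have fX: "?f r = f r" if "r \<in> X" for r using that pq by auto
  have ne: "f r \<in> X" "f r \<noteq> p" "f r \<noteq> q" "f r \<noteq> r" "f (f r) = r" if "r \<in> X" for r
    using that pq nc_involutionD[OF f] by auto
  have fp: "?f p = q" "?f q = p" using pq by auto
  have "((u < r) = (?f u < r)) = ((u < ?f r) = (?f u < ?f r))"
    if ur: "u \<in> ?X" "r \<in> ?X" "r \<noteq> u" "r \<noteq> ?f u" for u r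
  proof -
    consider "u \<in> {p, q}" | "u \<in> X" "r \<in> {p, q}" | "u \<in> X" "r \<in> X" using ur by blast
    then show ?thesis
    proof cases
      case 1
      then have "r \<in> X" using ur fp by auto
      then show ?thesis using nc[of r] 1 fp fX[of r] by auto
    next
      case 2
      then have "u \<noteq> p" "u \<noteq> q" using pq by auto
      then have flip: "(p < u) = (\<not> u < p)" "(q < u) = (\<not> u < q)"
        "(p < f u) = (\<not> f u < p)" "(q < f u) = (\<not> f u < q)"
        using ne[OF 2(1)] by auto
      have "((u < p) = (f u < p)) = ((u < q) = (f u < q))"
        using nc[OF 2(1)] unfolding flip by argo
      then show ?thesis using 2(2) fp fX[OF 2(1)] by auto
    next
      case 3
      then show ?thesis using nc_involutionD(4)[OF f, of u r] fX ur by auto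
    qed
  qed
  moreover have "?f u \<in> ?X \<and> ?f u \<noteq> u \<and> ?f (?f u) = u" if "u \<in> ?X" for u
    using that ne fX fp pq by (cases "u = p"; cases "u = q") auto
  ultimately show ?thesis unfolding nc_involution_def by blast
qed

text \<open>Cyclic bracket matching: an element p of A is matched with the next free non-element
  in cyclic order, and the gap g stays unmatched.\<close>
lemma exists_nc_involution_orientation:
  assumes "finite X" "A \<subseteq> X" "2 * card A = card X"
  shows "\<exists>f g. nc_involution X f \<and> (X \<noteq> {} \<longrightarrow> g \<in> X) \<and>
    (\<forall>p\<in>X. p < f p \<longrightarrow> (p \<in> A \<longleftrightarrow> \<not> (p \<le> g \<and> g < f p)) \<and> (f p \<in> A \<longleftrightarrow> p \<notin> A))"
  using assms
proof (induction "card X" arbitrary: X A rule: less_induct)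
  case less
  note fin = less.prems(1) and AX = less.prems(2) and cA = less.prems(3)
  show ?case
  proof (cases "X = {}")
    case True
    then show ?thesis by (simp add: nc_involution_def)
  next
    case False
    have finA: "finite A" using AX fin finite_subset by blast
    have "card X > 0" using False fin by (simp add: card_gt_0_iff)
    then have "A \<noteq> {}" "A \<noteq> X" using cA by auto
    then obtain x0 y0 where xy0: "x0 \<in> A" "y0 \<in> X - A" using AX by blast
    \<comment> \<open>Two kinds of pairs can be split off: an element of \<open>A\<close> directly
      followed by a non-element (\<open>p \<in> A\<close>, nothing between), or the pair that closes
      up cyclically (\<open>p \<notin> A\<close>, everything else between). In both cases the arc
      separates no two of the remaining points.\<close>
    have step: ?thesis if pq: "p \<in> X" "q \<in> X" "p < q" "(p \<in> A) \<noteq> (q \<in> A)"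
      and nosep: "\<And>r. r \<in> X \<Longrightarrow> r \<noteq> p \<Longrightarrow> r \<noteq> q \<Longrightarrow> (p < r \<and> r < q) = (p \<notin> A)"
    for p q
    proof -
      define X' where "X' = X - {p, q}"
      define A' where "A' = A - {p, q}"
      have cX': "card X = card X' + 2"
      proof -
        have "card X' = card X - card {p, q}"
          unfolding X'_def using pq by (intro card_Diff_subset) auto
        moreover have "card {p, q} \<le> card X" using pq fin by (intro card_mono) auto
        ultimately show ?thesis using pq by simp
      qed
      have cA': "card A = card A' + 1"
      proof -
        have "A' = A - {if p \<in> A then p else q}" using pq by (auto simp: A'_def)
        moreover have "(if p \<in> A then p else q) \<in> A" using pq by auto
        ultimately show ?thesis using finA by (metis Suc_eq_plus1 card.remove)
      qed
      have "card X' < card X" "finite X'" "A' \<subseteq> X'" "2 * card A' = card X'"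
        using cX' cA' cA fin AX by (auto simp: X'_def A'_def)
      from less.hyps[OF this] obtain f g where f: "nc_involution X' f" and g: "X' \<noteq> {} \<Longrightarrow> g \<in> X'"
        and ori: "\<And>r. r \<in> X' \<Longrightarrow> r < f r \<Longrightarrow>
          (r \<in> A' \<longleftrightarrow> \<not> (r \<le> g \<and> g < f r)) \<and> (f r \<in> A' \<longleftrightarrow> r \<notin> A')" by blast
      define f' where "f' = f(p := q, q := p)"
      \<comment> \<open>The gap \<open>g\<close> is the one just after the point \<open>g\<close>.
        If no points remain, it is placed outside the arc when \<open>p \<in> A\<close> and beneath
        it otherwise.\<close>
      define g' where "g' = (if X' = {} then (if p \<in> A then q else p) else g)"
      have XX': "X = insert p (insert q X')" using pq by (auto simp: X'_def)
      have sep: "(p < r \<and> r < q) = (p \<notin> A)" if "r \<in> X'" for r using nosep that by (auto simp: X'_def)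
      have fX': "f r \<in> X'" if "r \<in> X'" for r using nc_involutionD[OF f that] by simp
      have nc: "((p < r) = (q < r)) = ((p < f r) = (q < f r))" if "r \<in> X'" for r
        using sep[OF that] sep[OF fX'[OF that]] pq(3) that fX'[OF that] by (auto simp: X'_def)
      have "nc_involution X f'"
        unfolding f'_def XX' using nc pq by (intro nc_involution_insert[OF f]) (auto simp: X'_def)
      moreover have g'X: "g' \<in> X" using g pq by (auto simp: g'_def X'_def)
      moreover have "(r \<in> A \<longleftrightarrow> \<not> (r \<le> g' \<and> g' < f' r)) \<and> (f' r \<in> A \<longleftrightarrow> r \<notin> A)"
        if r: "r \<in> X" "r < f' r" for r
      proof -
        consider "r = p" | "r = q" | "r \<in> X'" using r XX' by blast
        then show ?thesis
        proof cases
          case 1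
          then have "f' r = q" using pq by (simp add: f'_def)
          moreover have "(p \<le> g' \<and> g' < q) = (p \<notin> A)"
          proof (cases "X' = {}")
            case True
            then show ?thesis using pq by (simp add: g'_def)
          next
            case False
            then have "g \<in> X'" "g \<noteq> p" using g by (auto simp: X'_def)
            then show ?thesis using sep[of g] False by (auto simp: g'_def)
          qed
          ultimately show ?thesis using 1 pq by auto
        next
          case 2
          then show ?thesis using r pq by (simp add: f'_def)
        next
          case 3
          then have "f' r = f r" "g' = g" by (auto simp: f'_def g'_def X'_def)
          moreover have "r \<in> A' \<longleftrightarrow> r \<in> A" "f r \<in> A' \<longleftrightarrow> f r \<in> A"
            using 3 fX'[OF 3] by (auto simp: A'_def X'_def)
          ultimately show ?thesis using ori[OF 3] r by simp
        qed
      qed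
      ultimately show ?thesis by blast
    qed
    show ?thesis
    proof (cases "\<exists>x y. x \<in> A \<and> y \<in> X - A \<and> x < y")
      case True
      then obtain x1 y1 where "x1 \<in> A \<and> y1 \<in> X - A \<and> x1 < y1" by blast
      then obtain x y where xy: "x \<in> A" "y \<in> X - A" "x < y"
        and min: "\<And>x' y'. x' \<in> A \<Longrightarrow> y' \<in> X - A \<Longrightarrow> x' < y' \<Longrightarrow> y - x \<le> y' - x'"
        using ex_has_least_nat[of "\<lambda>(x, y). x \<in> A \<and> y \<in> X - A \<and> x < y" "(x1, y1)" "\<lambda>(x, y). y - x"]
        by auto
      have "\<not> (x < r \<and> r < y)" if "r \<in> X" for r
        using min[of r y] min[of x r] xy that by (cases "r \<in> A") auto
      then show ?thesis using xy AX by (intro step[of x y]) auto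
    next
      case False
      \<comment> \<open>No element of \<open>A\<close> precedes a non-element, so the elements of
        \<open>A\<close> come last and the bracket is closed cyclically, from the last point to the
        first.\<close>
      define p q where "p = Min X" and "q = Max X"
      have pq: "p \<in> X" "q \<in> X" and le: "\<And>r. r \<in> X \<Longrightarrow> p \<le> r" "\<And>r. r \<in> X \<Longrightarrow> r \<le> q"
        using fin \<open>X \<noteq> {}\<close> by (auto simp: p_def q_def)
      have lt: "y < x" if "x \<in> A" "y \<in> X - A" for x y
        using False that by (metis DiffD2 nat_neq_iff)
      have "p \<notin> A" using lt[of p y0] le(1)[of y0] xy0 by auto
      moreover have "q \<in> A" using lt[of x0 q] le(2)[of x0] xy0 pq AX by (meson DiffI not_le subsetD)
      moreover have "p < q" using le(1)[of q] pq calculation by (metis le_neq_implies_less)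
      ultimately show ?thesis using pq le
        by (intro step[of p q]) (auto simp: less_le)
    qed
  qed
qed

section \<open>State weights and vectors in their kernel\<close>

definition spin :: "nat set \<Rightarrow> nat \<Rightarrow> int" where
  "spin A v = (if v \<in> A then 1 else -1)"

text \<open>\<open>A\<close> collects the points that an oriented curve crosses in the positive
  direction. An oriented arc leaves the line at one end and returns at the other, so exactly one end
  lies in \<open>A\<close>.\<close>

definition compat :: "nat \<Rightarrow> (nat \<Rightarrow> nat) \<Rightarrow> nat set \<Rightarrow> bool" where
  "compat N f A \<longleftrightarrow> (\<forall>v<N. f v \<in> A \<longleftrightarrow> v \<notin> A)"

text \<open>Here \<open>\<rho>\<close> is a fourth root of q: every arc is counted at both of its ends, so a half-turn
  contributes the square of \<open>\<rho>\<close> or its inverse. The powers of \<open>\<alpha>\<close> count the signed crossings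
  of the curves with a path along the boundary from the cut before point 0 to the gap g.\<close>
definition state_weight :: "real \<Rightarrow> real \<Rightarrow> nat \<Rightarrow> (nat \<Rightarrow> nat) \<Rightarrow> nat \<Rightarrow> nat set \<Rightarrow> real" where
  "state_weight \<rho> \<alpha> N f g A = (if compat N f A
     then \<rho> powi (\<Sum>v<N. spin A v * arc_dir f v) * \<alpha> powi (\<Sum>v\<le>g. spin A v) else 0)"

text \<open>\<open>kernel_vec\<close> lists the matrix entries of the divided power F^(k) of quantum sl2, where
  k = card t - card A sites of t are lowered; the sign makes up for the missing sign in the cups.\<close>
definition lowering_exp :: "nat set \<Rightarrow> nat set \<Rightarrow> int" where
  "lowering_exp t L = (\<Sum>l\<in>L. \<Sum>i\<in>{..<l} - L. spin t i)"

definition kernel_vec :: "real \<Rightarrow> nat set \<Rightarrow> nat set \<Rightarrow> real" where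
  "kernel_vec \<rho> t A = (if A \<subseteq> t then (-1) ^ \<Sum>(t - A) * \<rho> powi (- 4 * lowering_exp t (t - A)) else 0)"

lemma lowering_exp_insert:
  assumes "finite K" "x \<in> t" "x \<notin> K"
  shows "lowering_exp t (insert x K) = (\<Sum>l\<in>K. (\<Sum>i\<in>{..<l} - K. spin t i) - (if x < l then 1 else 0))
    + (\<Sum>i\<in>{..<x} - K. spin t i)"
proof -
  have "(\<Sum>i\<in>{..<l} - insert x K. spin t i) = (\<Sum>i\<in>{..<l} - K. spin t i) - (if x < l then 1 else 0)" for l
  proof (cases "x < l")
    case True
    have "{..<l} - insert x K = ({..<l} - K) - {x}" by auto
    then have "(\<Sum>i\<in>{..<l} - insert x K. spin t i) = (\<Sum>i\<in>{..<l} - K. spin t i) - spin t x"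
      using True assms by (simp add: sum_diff1)
    then show ?thesis using True assms by (simp add: spin_def)
  next
    case False
    then have "{..<l} - insert x K = {..<l} - K" by auto
    then show ?thesis using False by simp
  qed
  then show ?thesis using assms by (simp add: lowering_exp_def)
qed

text \<open>Moving the lowered site from \<open>p\<close> to \<open>p'\<close> adds the raised site
  \<open>p\<close> to the sum for \<open>p'\<close>, which gives 1. Each lowered site strictly
  between also regains \<open>p\<close>, which gives the card once; the unlowered sites between give
  it a second time, because by \<open>bal\<close> their signs balance the lowered ones.\<close>

lemma lowering_exp_swap:
  assumes K: "finite K" "p \<notin> K" "p' \<notin> K" and p: "p \<in> t" "p' \<in> t" "p < p'"
    and A: "A = t - insert p' K" and bal: "(\<Sum>i\<in>{p<..<p'}. spin A i) = 0"
  shows "lowering_exp t (insert p' K) - lowering_exp t (insert p K) = 1 + 2 * int (card (K \<inter> {p<..<p'}))"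
proof -
  let ?b = "int (card (K \<inter> {p<..<p'}))"
  let ?m = "\<Sum>i\<in>{p<..<p'} - K. spin t i"
  have "(\<Sum>l\<in>K. (if p < l then 1 else 0) - (if p' < l then 1 else 0 :: int))
      = (\<Sum>l\<in>K. if l \<in> {p<..<p'} then 1 else 0)"
  proof (intro sum.cong refl)
    fix l assume "l \<in> K"
    then have "l \<noteq> p'" using K by auto
    then show "(if p < l then 1 else 0) - (if p' < l then 1 else 0 :: int) = (if l \<in> {p<..<p'} then 1 else 0)"
      using p by auto
  qed
  also have "\<dots> = ?b" using K by (simp add: sum.If_cases Int_commute Int_def)
  finally have 1: "(\<Sum>l\<in>K. (if p < l then 1 else 0) - (if p' < l then 1 else 0 :: int)) = ?b" .
  have "{..<p'} - K = ({..<p} - K) \<union> insert p ({p<..<p'} - K)"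
    using p K by auto
  moreover have "sum (spin t) \<dots> = sum (spin t) ({..<p} - K) + sum (spin t) (insert p ({p<..<p'} - K))"
    by (rule sum.union_disjoint) auto
  ultimately have 2: "sum (spin t) ({..<p'} - K) = sum (spin t) ({..<p} - K) + 1 + ?m"
    using p by (simp add: spin_def)
  have "(\<Sum>i\<in>{p<..<p'}. spin A i) = (\<Sum>i\<in>{p<..<p'} - K. spin A i) + (\<Sum>i\<in>K \<inter> {p<..<p'}. spin A i)"
    by (subst sum.union_disjoint[symmetric]) (auto intro!: sum.cong)
  also have "(\<Sum>i\<in>{p<..<p'} - K. spin A i) = ?m"
    by (intro sum.cong) (auto simp: A spin_def)
  also have "(\<Sum>i\<in>K \<inter> {p<..<p'}. spin A i) = (\<Sum>i\<in>K \<inter> {p<..<p'}. - 1)"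
    by (intro sum.cong) (auto simp: A spin_def)
  finally have 3: "?m = ?b" using bal by simp
  show ?thesis
    using 1 2 3 unfolding lowering_exp_insert[OF K(1) p(1) K(2)] lowering_exp_insert[OF K(1) p(2) K(3)] sum_subtractf
    by simp
qed

lemma compat_swap:
  assumes f: "nc_involution {..<N} f" and u: "u < N" "u \<in> A" and A: "compat N f A"
  shows "compat N f (insert (f u) (A - {u}))"
  unfolding compat_def
proof (intro allI impI)
  fix v assume v: "v < N"
  have "f (f u) = u" "f u \<noteq> u" "f (f v) = v" using nc_involutionD[OF f] u v by auto
  then have "f v = f u \<longleftrightarrow> v = u" "f v = u \<longleftrightarrow> v = f u" by metis+
  moreover have "f u \<notin> A" using A u by (auto simp: compat_def)
  ultimately show "(f v \<in> insert (f u) (A - {u})) = (v \<notin> insert (f u) (A - {u}))"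
    using A v u \<open>f u \<noteq> u\<close> unfolding compat_def by auto
qed

text \<open>Reversing the arc at \<open>p\<close> divides the state weight by \<open>\<rho>\<close>
  to the 4, and by \<open>\<alpha>\<close> squared if the arc covers the gap. It multiplies the
  kernel vector by minus \<open>\<rho>\<close> to the 4 + 8b, where b counts the lowered sites
  strictly beneath the arc. The assumption \<open>bal\<close> says precisely that the two changes
  cancel up to the sign.\<close>

lemma state_weight_kernel_vec_swap:
  assumes f: "nc_involution {..<N} f" and p: "p < N" "p < f p" "p \<in> t" "f p \<in> t" and g: "g < N"
    and t: "t \<subseteq> {..<N}" and A: "A \<subseteq> t" "compat N f A" "p \<in> A" and \<rho>: "\<rho> > 0" "\<alpha> \<noteq> 0"
    and bal: "\<rho> powi (8 * int (card ((t - A) \<inter> {p<..<f p}))) = (if p \<le> g \<and> g < f p then \<alpha>\<^sup>2 else 1)"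
  shows "state_weight \<rho> \<alpha> N f g (insert (f p) (A - {p})) * kernel_vec \<rho> t (insert (f p) (A - {p})) = - (state_weight \<rho> \<alpha> N f g A * kernel_vec \<rho> t A)"
proof -
  define p' where "p' = f p"
  define A' where "A' = insert p' (A - {p})"
  define K where "K = t - A - {p'}"
  have pN: "p \<in> {..<N}" using p by simp
  have p'N: "p' < N" "p < p'" "f p' = p" using nc_involutionD[OF f pN] p by (auto simp: p'_def)
  have p'A: "p' \<notin> A" using A(2,3) p(1) unfolding compat_def p'_def by blast
  have LA: "t - A = insert p' K" "t - A' = insert p K"
    using p p'A A by (auto simp: K_def A'_def p'_def)
  have finK: "finite K" using t finite_subset by (auto simp: K_def)
  have K: "p \<notin> K" "p' \<notin> K" using A by (auto simp: K_def)
  have cA': "compat N f (insert (f p) (A - {p}))" using compat_swap[OF f p(1) A(3,2)] .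
  have spA: "spin A' v = spin A v" if "v \<noteq> p" "v \<noteq> p'" for v
    using that by (auto simp: spin_def A'_def)
  have spp: "spin A p = 1" "spin A p' = -1" "spin A' p = -1" "spin A' p' = 1"
    using A(3) p'A p'N by (auto simp: spin_def A'_def)
  have T: "(\<Sum>v<N. spin A v * arc_dir f v) = (\<Sum>v<N. spin A' v * arc_dir f v) + 4"
  proof -
    have "{..<N} = insert p (insert p' ({..<N} - {p, p'}))" using p p'N by auto
    then have s: "sum F {..<N} = F p + F p' + sum F ({..<N} - {p, p'})" for F :: "nat \<Rightarrow> int"
      using p'N(2) by (metis (no_types, lifting) add.assoc finite_lessThan finite_Diff finite_insert sum.insert
          Diff_iff insert_iff nat_neq_iff)
    have "arc_dir f p = 1" "arc_dir f p' = -1" using p'N by (auto simp: arc_dir_def p'_def[symmetric])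
    moreover have "(\<Sum>v\<in>{..<N} - {p, p'}. spin A' v * arc_dir f v) = (\<Sum>v\<in>{..<N} - {p, p'}. spin A v * arc_dir f v)"
      using spA by (intro sum.cong) auto
    ultimately show ?thesis using spp unfolding s by simp
  qed
  have H: "(\<Sum>v\<le>g. spin A v) = (\<Sum>v\<le>g. spin A' v) + (if p \<le> g \<and> g < p' then 2 else 0)"
  proof -
    have "spin A v = spin A' v + ((if v = p then 2 else 0) - (if v = p' then 2 else 0))" for v
      using spA[of v] spp p'N(2) by auto
    then have "(\<Sum>v\<le>g. spin A v) = (\<Sum>v\<le>g. spin A' v) + ((\<Sum>v\<le>g. if v = p then 2 else 0) - (\<Sum>v\<le>g. if v = p' then 2 else 0))"
      by (simp add: sum.distrib sum_subtractf)
    then show ?thesis using p'N(2) by (auto simp: sum.delta)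
  qed
  have bal0: "(\<Sum>i\<in>{p<..<p'}. spin A i) = 0"
  proof (rule sum_antisymmetric_involution[of _ f])
    fix v assume v: "v \<in> {p<..<p'}"
    then have vN: "v < N" using p'N by simp
    then show "f v \<in> {p<..<p'} \<and> f (f v) = v \<and> spin A (f v) = - spin A v"
      using between_closed[OF f pN, of v] nc_involutionD(3)[OF f, of v] v A(2)
      by (auto simp: p'_def compat_def spin_def)
  qed
  have "A = t - insert p' K" using LA(1) A(1) by auto
  from lowering_exp_swap[OF finK K _ _ p'N(2) this bal0] p
  have E: "lowering_exp t (t - A) = lowering_exp t (t - A') + 1 + 2 * int (card (K \<inter> {p<..<p'}))"
    by (simp add: LA p'_def)
  have KA: "K \<inter> {p<..<p'} = (t - A) \<inter> {p<..<p'}" by (auto simp: K_def)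
  define b where "b = int (card ((t - A) \<inter> {p<..<p'}))"
  \<comment> \<open>An even number of points lies beneath an arc, so its ends have different parity;
    this is why a sign given by the sum of positions flips.\<close>
  have odd: "odd (p + p')"
  proof -
    have "even (card {v \<in> {..<N}. p < v \<and> v < f p})"
      using even_between[OF f pN, of "{..<N}"] nc_involutionD(1)[OF f] by auto
    moreover have "{v \<in> {..<N}. p < v \<and> v < f p} = {p<..<p'}" using p'N by (auto simp: p'_def)
    ultimately show ?thesis using p'N(2) by (simp add: even_diff_nat)
  qed
  have "\<Sum>(t - A) + p = \<Sum>(t - A') + p'" using LA finK K by simp
  then have "even (\<Sum>(t - A)) \<longleftrightarrow> odd (\<Sum>(t - A'))" using odd by presburger
  then have sgn: "(-1 :: real) ^ \<Sum>(t - A) = - ((-1) ^ \<Sum>(t - A'))"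
    by (cases "even (\<Sum>(t - A))") auto
  have psiA: "kernel_vec \<rho> t A = (-1) ^ \<Sum>(t - A) * \<rho> powi (- 4 * lowering_exp t (t - A))" using A by (simp add: kernel_vec_def)
  have psiA': "kernel_vec \<rho> t A' = (-1) ^ \<Sum>(t - A') * \<rho> powi (- 4 * lowering_exp t (t - A'))"
    using A p by (auto simp: kernel_vec_def A'_def p'_def)
  have r0: "\<rho> \<noteq> 0" using \<rho> by simp
  have psi_rel: "kernel_vec \<rho> t A * \<rho> powi (4 + 8 * b) = - kernel_vec \<rho> t A'"
  proof -
    have "\<rho> powi (- 4 * lowering_exp t (t - A)) * \<rho> powi (4 + 8 * b) = \<rho> powi (- 4 * lowering_exp t (t - A'))"
      using r0 E KA by (simp flip: power_int_add add: b_def)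
    then show ?thesis unfolding psiA psiA' sgn by (simp add: mult.assoc)
  qed
  have wt_rel: "state_weight \<rho> \<alpha> N f g A = state_weight \<rho> \<alpha> N f g A' * \<rho> powi 4 * (if p \<le> g \<and> g < p' then \<alpha>\<^sup>2 else 1)"
  proof -
    have "\<alpha> powi (\<Sum>v\<le>g. spin A v) = \<alpha> powi (\<Sum>v\<le>g. spin A' v) * (if p \<le> g \<and> g < p' then \<alpha>\<^sup>2 else 1)"
      unfolding H using \<rho>(2) by (simp add: power_int_add)
    moreover have "\<rho> powi (\<Sum>v<N. spin A v * arc_dir f v) = \<rho> powi (\<Sum>v<N. spin A' v * arc_dir f v) * \<rho> powi 4"
      unfolding T using r0 by (subst power_int_add) auto
    ultimately show ?thesis using A(2) cA' by (simp add: state_weight_def A'_def p'_def)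
  qed
  have "state_weight \<rho> \<alpha> N f g A * kernel_vec \<rho> t A = state_weight \<rho> \<alpha> N f g A' * (kernel_vec \<rho> t A * (\<rho> powi 4 * \<rho> powi (8 * b)))"
    unfolding wt_rel using bal by (simp add: b_def p'_def)
  also have "\<rho> powi 4 * \<rho> powi (8 * b) = \<rho> powi (4 + 8 * b)" using r0 by (simp add: power_int_add)
  finally show "state_weight \<rho> \<alpha> N f g (insert (f p) (A - {p})) * kernel_vec \<rho> t (insert (f p) (A - {p})) = - (state_weight \<rho> \<alpha> N f g A * kernel_vec \<rho> t A)"
    using psi_rel by (simp add: A'_def p'_def)
qed

text \<open>A sign-reversing involution reverses one fixed arc with both ends in \<open>t\<close>.
  In every contributing state the partner of a lowered site is raised and hence in \<open>t\<close>,
  so there are \<open>k\<close> such arcs, with one lowered end each. The point is to find one for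
  which the balance condition holds in all states simultaneously.\<close>

lemma sum_state_weight_kernel_vec:
  assumes f: "nc_involution {..<2 * n} f" and g: "g < 2 * n"
    and t: "t \<subseteq> {..<2 * n}" "card t = n + k" and k: "k \<ge> 1"
    and \<rho>: "\<rho> > 0" "\<alpha> \<noteq> 0" "\<alpha>\<^sup>2 = \<rho> powi (8 * (int k - 1))"
  shows "(\<Sum>A | A \<subseteq> {..<2 * n} \<and> card A = n. state_weight \<rho> \<alpha> (2 * n) f g A * kernel_vec \<rho> t A) = 0"
proof -
  define C where "C = {A. A \<subseteq> t \<and> card A = n \<and> compat (2 * n) f A}"
  define T where "T A = state_weight \<rho> \<alpha> (2 * n) f g A * kernel_vec \<rho> t A" for A
  have fint: "finite t" using t finite_subset by blast
  have finC: "finite C" using fint by (auto simp: C_def)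
  have "(\<Sum>A | A \<subseteq> {..<2 * n} \<and> card A = n. T A) = (\<Sum>A\<in>C. T A)"
    by (rule sum.mono_neutral_right) (use t in \<open>auto simp: C_def T_def state_weight_def kernel_vec_def\<close>)
  also have "(\<Sum>A\<in>C. T A) = 0"
  proof (cases "C = {}")
    case False
    note fD = nc_involutionD[OF f]
    define P where "P p \<longleftrightarrow> p < 2 * n \<and> p < f p \<and> p \<in> t \<and> f p \<in> t" for p
    have lowered: "P (min l (f l))" "f (min l (f l)) = max l (f l)" if A: "A \<in> C" and l: "l \<in> t - A" for A l
    proof -
      have lN: "l < 2 * n" using l t by auto
      have "f l \<in> A" using A l lN by (auto simp: C_def compat_def)
      then have "f l \<in> t" using A by (auto simp: C_def)
      then show "P (min l (f l))" "f (min l (f l)) = max l (f l)"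
        using fD[of l] lN l by (cases "l < f l"; auto simp: P_def min_def max_def)+
    qed
    have card_lowered: "card (t - A) = k" if "A \<in> C" for A
      using that t fint by (auto simp: C_def card_Diff_subset finite_subset)
    obtain A0 where A0: "A0 \<in> C" using False by blast
    then have "t - A0 \<noteq> {}" using card_lowered[OF A0] k by (metis card.empty not_one_le_zero)
    then have exP: "\<exists>p. P p" using lowered[OF A0] by blast
    have "\<exists>p. P p \<and> (\<forall>A\<in>C. p \<in> A \<longrightarrow>
        \<rho> powi (8 * int (card ((t - A) \<inter> {p<..<f p}))) = (if p \<le> g \<and> g < f p then \<alpha>\<^sup>2 else 1))"
    proof (cases "\<exists>p. P p \<and> \<not> (p \<le> g \<and> g < f p)")
      \<comment> \<open>A shortest arc among those that miss the gap has no lowered site beneath it: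
        the arc of such a site would be shorter and would miss the gap too. Both sides of the
        balance are then 1.\<close>
      case True
      then have "\<exists>p. (P p \<and> \<not> (p \<le> g \<and> g < f p)) \<and>
          (\<forall>q. P q \<and> \<not> (q \<le> g \<and> g < f q) \<longrightarrow> f p - p \<le> f q - q)"
        by (elim exE, intro ex_has_least_nat)
      then obtain p where p: "P p" "\<not> (p \<le> g \<and> g < f p)"
        and min: "\<And>q. P q \<Longrightarrow> \<not> (q \<le> g \<and> g < f q) \<Longrightarrow> f p - p \<le> f q - q" by blast
      have "(t - A) \<inter> {p<..<f p} = {}" if A: "A \<in> C" for A
      proof (rule ccontr)
        assume "\<not> ?thesis"
        then obtain l where "l \<in> (t - A) \<inter> {p<..<f p}" by blast
        then have l: "l \<in> t - A" "p < l" "l < f p" by auto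
        then have "p < f l" "f l < f p"
          using between_closed[OF f, of p l] p t by (auto simp: P_def)
        then have "p < min l (f l)" "f (min l (f l)) < f p"
          using l lowered(2)[OF A l(1)] by auto
        moreover from calculation have "f p - p \<le> f (min l (f l)) - min l (f l)"
          using p by (intro min lowered(1)[OF A l(1)]) linarith
        moreover have "min l (f l) < f (min l (f l))" using lowered(1)[OF A l(1)] by (simp add: P_def)
        ultimately show False by linarith
      qed
      then show ?thesis using p by (intro exI[of _ p]) auto
    next
      \<comment> \<open>All these arcs cover the gap, hence are nested. Beneath the outermost one
        lie the lowered sites of the others, \<open>k - 1\<close> in number, since its own lowered
        site is its right end. This is the origin of the exponent in the assumption on
        \<open>\<alpha>\<close>.\<close>
      case False
      obtain p where p: "P p" and min: "\<And>q. P q \<Longrightarrow> p \<le> q"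
        using ex_has_least_nat[of P _ "\<lambda>p. p"] exP by blast
      have pg: "p \<le> g \<and> g < f p" using False p by blast
      have "card ((t - A) \<inter> {p<..<f p}) = k - 1" if A: "A \<in> C" "p \<in> A" for A
      proof -
        have "t - A = insert (f p) ((t - A) \<inter> {p<..<f p})"
        proof (intro equalityI subsetI)
          fix l assume l: "l \<in> t - A"
          let ?m = "min l (f l)"
          have m: "P ?m" "f ?m = max l (f l)" using lowered[OF A(1) l] .
          have lN: "l \<in> {..<2 * n}" and pN: "p \<in> {..<2 * n}" using l t p by (auto simp: P_def)
          have gm: "?m \<le> g" using False m by blast
          show "l \<in> insert (f p) ((t - A) \<inter> {p<..<f p})"
          proof (cases "?m = p")
            case True
            then have "l = f p" using fD(3)[OF lN] A(2) l by (auto simp: min_def split: if_splits)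
            then show ?thesis by simp
          next
            case ne: False
            have mN: "?m \<in> {..<2 * n}" using m by (simp add: P_def)
            have b: "p < ?m" "?m < f p" using min[OF m(1)] ne gm pg by auto
            have "p < f ?m" "f ?m < f p" using between_closed[OF f pN mN b] .
            then show ?thesis using b l unfolding m(2) by auto
          qed
        next
          fix l assume "l \<in> insert (f p) ((t - A) \<inter> {p<..<f p})"
          then show "l \<in> t - A" using p A by (auto simp: P_def C_def compat_def)
        qed
        also have "card \<dots> = Suc (card ((t - A) \<inter> {p<..<f p}))"
          using fint by (intro card_insert_disjoint) auto
        finally have "card (t - A) = Suc (card ((t - A) \<inter> {p<..<f p}))" .
        then show ?thesis using card_lowered[OF A(1)] by simp
      qed
      then show ?thesis using p pg \<rho>(3) k by (intro exI[of _ p]) (auto simp: of_nat_diff)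
    qed
    then obtain p where p: "P p" and bal: "\<And>A. A \<in> C \<Longrightarrow> p \<in> A \<Longrightarrow>
        \<rho> powi (8 * int (card ((t - A) \<inter> {p<..<f p}))) = (if p \<le> g \<and> g < f p then \<alpha>\<^sup>2 else 1)"
      by blast
    define C1 where "C1 = {A \<in> C. p \<in> A}"
    define C2 where "C2 = {A \<in> C. p \<notin> A}"
    have pD: "p < 2 * n" "p < f p" "p \<in> t" "f p \<in> t" using p by (auto simp: P_def)
    have fp: "f p < 2 * n" "f (f p) = p" using fD[of p] pD by auto
    have fpA: "f p \<in> A \<longleftrightarrow> p \<notin> A" if "A \<in> C" for A using that pD by (auto simp: C_def compat_def)
    have swapC: "insert (f u) (A - {u}) \<in> C" if A: "A \<in> C" "u \<in> {p, f p}" "u \<in> A" for A u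
    proof -
      have u: "u < 2 * n" using A pD fp by auto
      have fu: "f u \<notin> A" using A u by (auto simp: C_def compat_def)
      have finA: "finite A" using A fint finite_subset by (auto simp: C_def)
      have "card (insert (f u) (A - {u})) = Suc (card (A - {u}))"
        using fu finA by (intro card_insert_disjoint) auto
      also have "\<dots> = card A" by (rule card.remove[OF finA A(3), symmetric])
      finally have "card (insert (f u) (A - {u})) = card A" .
      moreover have "f u \<in> t" using A pD fp by auto
      ultimately show ?thesis using A compat_swap[OF f u] by (auto simp: C_def)
    qed
    have "(\<Sum>A\<in>C2. T A) = (\<Sum>A\<in>C1. - T A)"
    proof (rule sum.reindex_bij_witness[of _ "\<lambda>A. insert (f p) (A - {p})" "\<lambda>A. insert p (A - {f p})"])
      fix A assume A: "A \<in> C2"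
      then have AC: "A \<in> C" "p \<notin> A" "f p \<in> A" using fpA by (auto simp: C2_def)
      show undo: "insert (f p) (insert p (A - {f p}) - {p}) = A" using AC by auto
      show C1: "insert p (A - {f p}) \<in> C1" using swapC[of A "f p"] AC fp by (auto simp: C1_def)
      have "state_weight \<rho> \<alpha> (2 * n) f g (insert (f p) (insert p (A - {f p}) - {p})) * kernel_vec \<rho> t (insert (f p) (insert p (A - {f p}) - {p}))
        = - (state_weight \<rho> \<alpha> (2 * n) f g (insert p (A - {f p})) * kernel_vec \<rho> t (insert p (A - {f p})))"
        using C1 bal[of "insert p (A - {f p})"]
        by (intro state_weight_kernel_vec_swap[OF f pD g t(1) _ _ _ \<rho>(1,2)]) (auto simp: C1_def C_def)
      then show "- T (insert p (A - {f p})) = T A" unfolding T_def undo by simp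
    next
      fix A assume A: "A \<in> C1"
      then have AC: "A \<in> C" "p \<in> A" "f p \<notin> A" using fpA by (auto simp: C1_def)
      show "insert p (insert (f p) (A - {p}) - {f p}) = A" using AC by auto
      show "insert (f p) (A - {p}) \<in> C2" using swapC[of A p] AC pD by (auto simp: C2_def)
    qed
    moreover have "(\<Sum>A\<in>C. T A) = (\<Sum>A\<in>C1. T A) + (\<Sum>A\<in>C2. T A)"
      by (subst sum.union_disjoint[symmetric]) (use finC in \<open>auto simp: C1_def C2_def intro!: sum.cong\<close>)
    ultimately show ?thesis by (simp add: sum_negf)
  qed simp
  finally show ?thesis by (simp add: T_def)
qed

section \<open>Independence of the kernel vectors\<close>

lemma sum_Pow_alternating:
  assumes "finite Z"
  shows "(\<Sum>e\<in>Pow Z. (-1) ^ card e) = (if Z = {} then 1 else 0 :: 'a::comm_ring_1)"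
  using assms
proof (induction Z rule: finite_induct)
  case (insert z Z)
  have "inj_on (insert z) (Pow Z)" using insert.hyps by (auto simp: inj_on_def)
  moreover have "card (insert z e) = Suc (card e)" if "e \<in> Pow Z" for e
    using that insert.hyps finite_subset[of e Z] by (intro card_insert_disjoint) auto
  ultimately have "(\<Sum>e\<in>insert z ` Pow Z. (-1) ^ card e) = - (\<Sum>e\<in>Pow Z. (-1) ^ card e :: 'a)"
    by (simp add: sum.reindex sum_negf)
  then show ?case
    using insert.hyps by (subst Pow_insert, subst sum.union_disjoint) auto
qed simp

lemma card_intermediate_subsets:
  assumes "finite t" "e \<subseteq> t" "card e \<le> b"
  shows "card {s. e \<subseteq> s \<and> s \<subseteq> t \<and> card s = b} = (card t - card e) choose (b - card e)"
proof -
  have fe: "finite e" using assms finite_subset by blast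
  have "bij_betw (\<lambda>s. s - e) {s. e \<subseteq> s \<and> s \<subseteq> t \<and> card s = b} {r. r \<subseteq> t - e \<and> card r = b - card e}"
  proof (rule bij_betwI[where g = "\<lambda>r. r \<union> e"])
    show "(\<lambda>s. s - e) \<in> {s. e \<subseteq> s \<and> s \<subseteq> t \<and> card s = b} \<rightarrow> {r. r \<subseteq> t - e \<and> card r = b - card e}"
      using fe by (auto simp: card_Diff_subset)
    show "(\<lambda>r. r \<union> e) \<in> {r. r \<subseteq> t - e \<and> card r = b - card e} \<rightarrow> {s. e \<subseteq> s \<and> s \<subseteq> t \<and> card s = b}"
    proof (intro funcsetI CollectI conjI)
      fix r assume r: "r \<in> {r. r \<subseteq> t - e \<and> card r = b - card e}"
      then have "finite r" using assms(1) finite_subset by blast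
      then have "card (r \<union> e) = card r + card e" using fe r by (intro card_Un_disjoint) auto
      then show "card (r \<union> e) = b" using r assms(3) by simp
    qed (use assms in auto)
  qed auto
  then have "card {s. e \<subseteq> s \<and> s \<subseteq> t \<and> card s = b} = card {r. r \<subseteq> t - e \<and> card r = b - card e}"
    by (rule bij_betw_same_card)
  also have "\<dots> = card (t - e) choose (b - card e)"
    using assms by (intro n_subsets) auto
  finally show ?thesis using assms fe by (simp add: card_Diff_subset)
qed

text \<open>Gottlieb's theorem on the rank of inclusion matrices, with an explicit left inverse.\<close>
lemma inclusion_matrix_left_inverse:
  fixes t t0 U :: "'a set"
  assumes U: "finite U" "t \<subseteq> U" "t0 \<subseteq> U" "card t = a" "card t0 = a" and ab: "b \<le> a" "card U \<le> a + b"
  shows "(\<Sum>s | s \<subseteq> t \<and> card s = b.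
      \<Sum>e\<in>Pow (s - t0). (-1) ^ card e / real ((a - card e) choose (b - card e))) = (if t = t0 then 1 else 0)"
proof -
  let ?F = "\<lambda>e. (-1) ^ card e / real ((a - card e) choose (b - card e))"
  let ?B = "{s. s \<subseteq> t \<and> card s = b}"
  have fin: "finite t" "finite t0" using U finite_subset by auto
  have finB: "finite ?B" using fin by auto
  have "(\<Sum>s\<in>?B. \<Sum>e\<in>Pow (s - t0). ?F e) = (\<Sum>s\<in>?B. \<Sum>e\<in>{e \<in> Pow (t - t0). e \<subseteq> s}. ?F e)"
    by (intro sum.cong) auto
  also have "\<dots> = (\<Sum>e\<in>Pow (t - t0). \<Sum>s\<in>{s \<in> ?B. e \<subseteq> s}. ?F e)"
    using finB fin by (intro sum.swap_restrict) auto
  \<comment> \<open>The number of \<open>s\<close> between \<open>e\<close> and \<open>t\<close> is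
    the binomial coefficient in the denominator. Since \<open>e\<close> avoids \<open>t0\<close>,
    the bound on \<open>card U\<close> forces \<open>card e \<le> b\<close>, where this count
    applies.\<close>
  also have "\<dots> = (\<Sum>e\<in>Pow (t - t0). (-1) ^ card e)"
  proof (intro sum.cong refl)
    fix e assume e: "e \<in> Pow (t - t0)"
    have "card e \<le> card (U - t0)" using e U by (intro card_mono) auto
    also have "\<dots> = card U - a" using U fin by (simp add: card_Diff_subset)
    finally have eb: "card e \<le> b" using ab by simp
    have "{s \<in> ?B. e \<subseteq> s} = {s. e \<subseteq> s \<and> s \<subseteq> t \<and> card s = b}" by auto
    then have "card {s \<in> ?B. e \<subseteq> s} = (a - card e) choose (b - card e)"
      using card_intermediate_subsets[OF fin(1) _ eb] e U by auto
    moreover have "\<dots> > 0" using ab by (intro zero_less_binomial) auto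
    ultimately show "(\<Sum>s\<in>{s \<in> ?B. e \<subseteq> s}. ?F e) = (-1) ^ card e" by simp
  qed
  also have "\<dots> = (if t - t0 = {} then 1 else 0)"
    using fin by (intro sum_Pow_alternating) auto
  also have "t - t0 = {} \<longleftrightarrow> t = t0"
    using U fin by (metis Diff_eq_empty_iff card_subset_eq order_refl)
  finally show ?thesis .
qed

text \<open>Diagonal dominance: at an index where the modulus of \<open>b\<close> is maximal, the
  deviation from the identity accounts for at most the fraction c/(c + 1) of that modulus, with c =
  \<open>card T\<close>.\<close>

lemma trivial_kernel_near_identity:
  fixes M :: "'t \<Rightarrow> 't \<Rightarrow> real"
  assumes T: "finite T" and M: "\<And>t t'. t \<in> T \<Longrightarrow> t' \<in> T \<Longrightarrow>
      \<bar>M t t' - (if t' = t then 1 else 0)\<bar> < 1 / (real (card T) + 1)"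
    and b: "\<And>t. t \<in> T \<Longrightarrow> (\<Sum>t'\<in>T. M t t' * b t') = 0"
  shows "\<forall>t\<in>T. b t = 0"
proof (cases "T = {}")
  case False
  obtain t where t: "t \<in> T" "\<bar>b t\<bar> = Max ((\<lambda>t. \<bar>b t\<bar>) ` T)"
    using Max_in[of "(\<lambda>t. \<bar>b t\<bar>) ` T"] T False by fastforce
  have max: "\<bar>b t'\<bar> \<le> \<bar>b t\<bar>" if "t' \<in> T" for t' using that T t(2) by simp
  let ?c = "real (card T)"
  have "b t = (\<Sum>t'\<in>T. if t' = t then b t' else 0) - (\<Sum>t'\<in>T. M t t' * b t')"
    using t(1) T b[OF t(1)] by simp
  also have "\<dots> = (\<Sum>t'\<in>T. ((if t' = t then 1 else 0) - M t t') * b t')"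
    unfolding sum_subtractf[symmetric] by (intro sum.cong) (auto simp: left_diff_distrib)
  finally have "\<bar>b t\<bar> \<le> (\<Sum>t'\<in>T. \<bar>((if t' = t then 1 else 0) - M t t') * b t'\<bar>)"
    by (metis sum_abs)
  also have "\<dots> \<le> (\<Sum>t'\<in>T. 1 / (?c + 1) * \<bar>b t\<bar>)"
    unfolding abs_mult
    by (intro sum_mono mult_mono) (use M[OF t(1)] max in \<open>auto simp: abs_minus_commute less_imp_le\<close>)
  also have "\<dots> = ?c / (?c + 1) * \<bar>b t\<bar>" by simp
  finally have "\<bar>b t\<bar> * (?c + 1) \<le> ?c * \<bar>b t\<bar>" by (simp add: field_simps)
  then have "b t = 0" by (simp add: algebra_simps)
  then show ?thesis using max by auto
qed simp

text \<open>For \<open>\<rho> = 1\<close> the vectors form a signed inclusion matrix with left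
  inverse \<open>\<Lambda>\<close>; the sign in \<open>\<Lambda>\<close> turns the one depending on
  \<open>t - A\<close> into a sign depending on \<open>t\<close> and \<open>t'\<close> only, which
  is 1 on the diagonal. With \<open>\<Lambda>\<close> kept fixed, the product \<open>M\<close> is
  continuous in \<open>\<rho>\<close>, hence close to the identity near 1.\<close>

lemma kernel_vec_independent_near_one:
  assumes "k \<le> n"
  defines "\<Sigma> \<equiv> {A. A \<subseteq> {..<2 * n} \<and> card A = n}"
    and "T \<equiv> {t. t \<subseteq> {..<2 * n} \<and> card t = n + k}"
  shows "eventually (\<lambda>\<rho>. \<forall>b. (\<forall>A\<in>\<Sigma>. (\<Sum>t\<in>T. b t * kernel_vec \<rho> t A) = 0) \<longrightarrow> (\<forall>t\<in>T. b t = 0)) (at_right 1)"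
proof -
  define \<Lambda> where "\<Lambda> t A = (-1) ^ (\<Sum>A + \<Sum>t) *
    (\<Sum>e\<in>Pow (A - t). (-1) ^ card e / real ((n + k - card e) choose (n - card e)))" for t A :: "nat set"
  define M where "M \<rho> t t' = (\<Sum>A\<in>\<Sigma>. \<Lambda> t A * kernel_vec \<rho> t' A)" for \<rho> t t'
  have fin: "finite \<Sigma>" "finite T" by (auto simp: \<Sigma>_def T_def)
  have M1: "M 1 t t' = (if t' = t then 1 else 0)" if t: "t \<in> T" "t' \<in> T" for t t'
  proof -
    have ft': "finite t'" using t finite_subset by (auto simp: T_def)
    have "M 1 t t' = (\<Sum>A\<in>{A. A \<subseteq> t' \<and> card A = n}. \<Lambda> t A * kernel_vec 1 t' A)"
      unfolding M_def by (rule sum.mono_neutral_right) (use t fin in \<open>auto simp: \<Sigma>_def T_def kernel_vec_def\<close>)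
    also have "\<dots> = (\<Sum>A\<in>{A. A \<subseteq> t' \<and> card A = n}. (-1) ^ (\<Sum>t' + \<Sum>t) *
        (\<Sum>e\<in>Pow (A - t). (-1) ^ card e / real ((n + k - card e) choose (n - card e))))"
    proof (intro sum.cong refl)
      fix A assume A: "A \<in> {A. A \<subseteq> t' \<and> card A = n}"
      then have "\<Sum>t' = \<Sum>A + \<Sum>(t' - A)" using ft' sum.subset_diff[of A t' "\<lambda>x. x"] by simp
      then have "(-1 :: real) ^ (\<Sum>A + \<Sum>t) * (-1) ^ \<Sum>(t' - A) = (-1) ^ (\<Sum>t' + \<Sum>t)"
        by (simp add: power_add mult_ac)
      then show "\<Lambda> t A * kernel_vec 1 t' A = (-1) ^ (\<Sum>t' + \<Sum>t) *
        (\<Sum>e\<in>Pow (A - t). (-1) ^ card e / real ((n + k - card e) choose (n - card e)))"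
        using A by (simp add: \<Lambda>_def kernel_vec_def mult_ac)
    qed
    also have "\<dots> = (-1) ^ (\<Sum>t' + \<Sum>t) * (if t' = t then 1 else 0)"
      unfolding sum_distrib_left[symmetric]
      by (subst inclusion_matrix_left_inverse[of "{..<2 * n}"]) (use t in \<open>auto simp: T_def\<close>)
    also have "\<dots> = (if t' = t then 1 else 0)" by (simp flip: mult_2 add: power_mult)
    finally show ?thesis .
  qed
  have "((\<lambda>\<rho>. kernel_vec \<rho> t A) \<longlongrightarrow> kernel_vec 1 t A) (at_right 1)" for t A
  proof (cases "A \<subseteq> t")
    case True
    show ?thesis
      unfolding kernel_vec_def if_P[OF True] by (intro tendsto_mult tendsto_const tendsto_power_int tendsto_ident_at) simp
  qed (simp add: kernel_vec_def)
  then have lim: "((\<lambda>\<rho>. M \<rho> t t') \<longlongrightarrow> M 1 t t') (at_right 1)" for t t'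
    unfolding M_def by (intro tendsto_intros)
  have "eventually (\<lambda>\<rho>. \<bar>M \<rho> t t' - (if t' = t then 1 else 0)\<bar> < 1 / (real (card T) + 1)) (at_right 1)"
    if "t \<in> T" "t' \<in> T" for t t'
    using tendstoD[OF lim[of t t'], of "1 / (real (card T) + 1)"]
    unfolding M1[OF that] dist_real_def by simp
  then have "eventually (\<lambda>\<rho>. \<forall>t\<in>T. \<forall>t'\<in>T. \<bar>M \<rho> t t' - (if t' = t then 1 else 0)\<bar> < 1 / (real (card T) + 1)) (at_right 1)"
    using fin by (intro eventually_ball_finite ballI) auto
  then show ?thesis
  proof (rule eventually_mono)
    fix \<rho> assume near: "\<forall>t\<in>T. \<forall>t'\<in>T. \<bar>M \<rho> t t' - (if t' = t then 1 else 0)\<bar> < 1 / (real (card T) + 1)"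
    show "\<forall>b. (\<forall>A\<in>\<Sigma>. (\<Sum>t\<in>T. b t * kernel_vec \<rho> t A) = 0) \<longrightarrow> (\<forall>t\<in>T. b t = 0)"
    proof (intro allI impI)
      fix b assume b: "\<forall>A\<in>\<Sigma>. (\<Sum>t\<in>T. b t * kernel_vec \<rho> t A) = 0"
      show "\<forall>t\<in>T. b t = 0"
      proof (rule trivial_kernel_near_identity[OF fin(2)])
        fix t assume "t \<in> T"
        have "(\<Sum>t'\<in>T. M \<rho> t t' * b t') = (\<Sum>t'\<in>T. \<Sum>A\<in>\<Sigma>. \<Lambda> t A * (b t' * kernel_vec \<rho> t' A))"
          unfolding M_def sum_distrib_right by (intro sum.cong) (auto simp: mult_ac)
        also have "\<dots> = (\<Sum>A\<in>\<Sigma>. \<Lambda> t A * (\<Sum>t'\<in>T. b t' * kernel_vec \<rho> t' A))"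
          unfolding sum_distrib_left by (rule sum.swap)
        also have "\<dots> = 0" using b by simp
        finally show "(\<Sum>t'\<in>T. M \<rho> t t' * b t') = 0" .
      qed (use near in auto)
    qed
  qed
qed

section \<open>The state sum of a meander\<close>

lemma power_int_sum:
  fixes x :: "'a::field"
  assumes "x \<noteq> 0"
  shows "x powi (\<Sum>i\<in>I. e i) = (\<Prod>i\<in>I. x powi e i)"
  by (induction I rule: infinite_finite_induct) (simp_all add: assms power_int_add)

text \<open>The partial sums of 1, -1, 1, ... are 1 and 0 in turn. Thus the signed crossings of one
  curve with the path to a gap reduce to a parity.\<close>

lemma alt_sign_prefix_sum:
  assumes "finite \<gamma>"
  shows "(\<Sum>v\<in>{v \<in> \<gamma>. v \<le> g}. alt_sign \<gamma> v) = (if odd (card {v \<in> \<gamma>. v \<le> g}) then 1 else 0)"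
proof (induction g)
  case 0
  have "{v \<in> \<gamma>. v \<le> 0} = (if 0 \<in> \<gamma> then {0} else {})" by auto
  moreover have "alt_sign \<gamma> 0 = 1" by (simp add: alt_sign_def)
  ultimately show ?case by simp
next
  case (Suc g)
  show ?case
  proof (cases "Suc g \<in> \<gamma>")
    case True
    then have e: "{v \<in> \<gamma>. v \<le> Suc g} = insert (Suc g) {v \<in> \<gamma>. v \<le> g}" by (auto simp: le_Suc_eq)
    have "alt_sign \<gamma> (Suc g) = (if even (card {v \<in> \<gamma>. v \<le> g}) then 1 else -1)"
      by (simp add: alt_sign_def less_Suc_eq_le)
    then show ?thesis unfolding e using Suc assms by simp
  next
    case False
    then have "{v \<in> \<gamma>. v \<le> Suc g} = {v \<in> \<gamma>. v \<le> g}" by (auto simp: le_Suc_eq)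
    then show ?thesis using Suc by simp
  qed
qed

lemma nc_involution_subset:
  assumes "nc_involution X f" "Y \<subseteq> X" "\<And>v. v \<in> Y \<Longrightarrow> f v \<in> Y"
  shows "nc_involution Y f"
  using assms unfolding nc_involution_def by blast

lemma alt_sign_cases: "alt_sign X v = 1 \<or> alt_sign X v = -1" by (simp add: alt_sign_def)

lemma spin_cases: "spin A v = 1 \<or> spin A v = -1" by (simp add: spin_def)

lemma compat_spin: "compat N f A \<longleftrightarrow> (\<forall>v<N. spin A (f v) = - spin A v)"
  by (auto simp: compat_def spin_def)

lemma compat_card:
  assumes f: "nc_involution {..<2 * n} f" and A: "A \<subseteq> {..<2 * n}" "compat (2 * n) f A"
  shows "card A = n"
proof -
  have "(\<Sum>v<2 * n. spin A v) = 0"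
    using nc_involutionD[OF f] A(2) by (intro sum_antisymmetric_involution[of _ f]) (auto simp: compat_spin)
  moreover have "(\<Sum>v<2 * n. spin A v) = (\<Sum>v<2 * n. 2 * (if v \<in> A then 1 else 0) - 1)"
    by (intro sum.cong) (auto simp: spin_def)
  moreover have "\<dots> = 2 * int (card A) - 2 * int n"
    using A(1) by (simp add: sum_subtractf sum_distrib_left[symmetric] sum.If_cases Int_absorb1)
  ultimately show ?thesis by simp
qed

text \<open>The curves are characterized as the minimal nonempty sets closed under both involutions,
  so connectedness can be used without paths.\<close>

locale meander =
  fixes N :: nat and f1 f2 :: "nat \<Rightarrow> nat" and C :: "nat set set"
  assumes f1: "nc_involution {..<N} f1" and f2: "nc_involution {..<N} f2"
    and Union_C: "\<Union>C = {..<N}" and disjoint_C: "\<And>\<gamma> \<gamma>'. \<gamma> \<in> C \<Longrightarrow> \<gamma>' \<in> C \<Longrightarrow> \<gamma> \<noteq> \<gamma>' \<Longrightarrow> \<gamma> \<inter> \<gamma>' = {}"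
    and nonempty_C: "\<And>\<gamma>. \<gamma> \<in> C \<Longrightarrow> \<gamma> \<noteq> {}"
    and closed_C: "\<And>\<gamma> v. \<gamma> \<in> C \<Longrightarrow> v \<in> \<gamma> \<Longrightarrow> f1 v \<in> \<gamma> \<and> f2 v \<in> \<gamma>"
    and connected_C: "\<And>\<gamma> Y. \<gamma> \<in> C \<Longrightarrow> Y \<subseteq> \<gamma> \<Longrightarrow> Y \<noteq> {} \<Longrightarrow> (\<And>v. v \<in> Y \<Longrightarrow> f1 v \<in> Y \<and> f2 v \<in> Y) \<Longrightarrow> Y = \<gamma>"
begin

lemma C_subset: "\<gamma> \<in> C \<Longrightarrow> \<gamma> \<subseteq> {..<N}"
  using Union_C by auto

lemma component_exists:
  assumes "v < N"
  obtains \<gamma> where "\<gamma> \<in> C" "v \<in> \<gamma>"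
proof -
  have "v \<in> \<Union>C" unfolding Union_C using assms by simp
  then show ?thesis using that by (elim UnionE)
qed

lemma finite_component: "\<gamma> \<in> C \<Longrightarrow> finite \<gamma>"
  using C_subset finite_subset by blast

lemma finite_C: "finite C"
  using Union_C by (metis finite_UnionD finite_lessThan)

lemma component_unique: "\<gamma> \<in> C \<Longrightarrow> \<gamma>' \<in> C \<Longrightarrow> v \<in> \<gamma> \<Longrightarrow> v \<in> \<gamma>' \<Longrightarrow> \<gamma> = \<gamma>'"
  using disjoint_C by blast

lemma sum_components: "sum F {..<N} = (\<Sum>\<gamma>\<in>C. sum F \<gamma>)"
  unfolding Union_C[symmetric]
  using sum.Union_disjoint[of C F] finite_component disjoint_C by simp

lemma nc_component: "\<gamma> \<in> C \<Longrightarrow> nc_involution \<gamma> f1" "\<gamma> \<in> C \<Longrightarrow> nc_involution \<gamma> f2"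
  using nc_involution_subset[OF f1 C_subset] nc_involution_subset[OF f2 C_subset] closed_C by blast+

lemma alt_sign_flip:
  assumes "\<gamma> \<in> C" "v \<in> \<gamma>"
  shows "alt_sign \<gamma> (f1 v) = - alt_sign \<gamma> v" "alt_sign \<gamma> (f2 v) = - alt_sign \<gamma> v"
  using alt_sign_partner[OF nc_component(1)[OF assms(1)] finite_component[OF assms(1)] assms(2)]
    alt_sign_partner[OF nc_component(2)[OF assms(1)] finite_component[OF assms(1)] assms(2)] .

definition compats :: "nat set set" where
  "compats = {A. A \<subseteq> {..<N} \<and> compat N f1 A \<and> compat N f2 A}"

definition spins :: "(nat set \<Rightarrow> int) \<Rightarrow> nat set" where
  "spins \<epsilon> = {v. \<exists>\<gamma>\<in>C. v \<in> \<gamma> \<and> \<epsilon> \<gamma> * alt_sign \<gamma> v = 1}"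

lemma spin_spins:
  assumes "\<epsilon> \<in> C \<rightarrow>\<^sub>E {1, -1}" "\<gamma> \<in> C" "v \<in> \<gamma>"
  shows "spin (spins \<epsilon>) v = \<epsilon> \<gamma> * alt_sign \<gamma> v"
proof -
  have "v \<in> spins \<epsilon> \<longleftrightarrow> \<epsilon> \<gamma> * alt_sign \<gamma> v = 1"
    using component_unique assms by (auto simp: spins_def)
  moreover have "\<epsilon> \<gamma> \<in> {1, -1}" using assms by (auto simp: PiE_def Pi_def)
  ultimately show ?thesis using alt_sign_cases[of \<gamma> v] by (auto simp: spin_def)
qed

text \<open>Both factors change sign along every arc, so their product is constant on a connected
  component.\<close>

lemma spin_component:
  assumes A: "A \<in> compats" and \<gamma>: "\<gamma> \<in> C" "u \<in> \<gamma>" "v \<in> \<gamma>"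
  shows "spin A u * alt_sign \<gamma> u = spin A v * alt_sign \<gamma> v"
proof -
  let ?Y = "{w \<in> \<gamma>. spin A w * alt_sign \<gamma> w = spin A v * alt_sign \<gamma> v}"
  have "?Y = \<gamma>"
  proof (rule connected_C[OF \<gamma>(1)])
    fix w assume w: "w \<in> ?Y"
    then have "w < N" using C_subset[OF \<gamma>(1)] by auto
    then show "f1 w \<in> ?Y \<and> f2 w \<in> ?Y"
      using A w closed_C[OF \<gamma>(1)] alt_sign_flip[OF \<gamma>(1)] by (auto simp: compats_def compat_spin)
  qed (use \<gamma> in auto)
  then show ?thesis using \<gamma>(2) by blast
qed

text \<open>An orientation of the whole gluing is one sign per curve, namely its comparison with
  \<open>alt_sign\<close>. The sign can be read off at any point of the curve;
  \<open>Min \<gamma>\<close> is such a point.\<close>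

lemma bij_spins: "bij_betw spins (C \<rightarrow>\<^sub>E {1, -1}) compats"
proof (rule bij_betwI[where g = "\<lambda>A. restrict (\<lambda>\<gamma>. spin A (Min \<gamma>) * alt_sign \<gamma> (Min \<gamma>)) C"])
  show "spins \<in> (C \<rightarrow>\<^sub>E {1, -1}) \<rightarrow> compats"
  proof
    fix \<epsilon> assume \<epsilon>: "\<epsilon> \<in> C \<rightarrow>\<^sub>E {1, -1 :: int}"
    have "spin (spins \<epsilon>) (f1 v) = - spin (spins \<epsilon>) v \<and> spin (spins \<epsilon>) (f2 v) = - spin (spins \<epsilon>) v" if v: "v < N" for v
    proof -
      obtain \<gamma> where \<gamma>: "\<gamma> \<in> C" "v \<in> \<gamma>" by (rule component_exists[OF v])
      then have "f1 v \<in> \<gamma>" "f2 v \<in> \<gamma>" using closed_C by auto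
      then show ?thesis using spin_spins[OF \<epsilon> \<gamma>(1)] \<gamma>(2) alt_sign_flip[OF \<gamma>] by simp
    qed
    then show "spins \<epsilon> \<in> compats" using C_subset by (auto simp: compats_def compat_spin spins_def)
  qed
  have Min: "Min \<gamma> \<in> \<gamma>" if "\<gamma> \<in> C" for \<gamma> using Min_in finite_component nonempty_C that by blast
  show "(\<lambda>A. restrict (\<lambda>\<gamma>. spin A (Min \<gamma>) * alt_sign \<gamma> (Min \<gamma>)) C) \<in> compats \<rightarrow> C \<rightarrow>\<^sub>E {1, -1}"
  proof (intro funcsetI restrict_PiE_iff[THEN iffD2] ballI)
    fix A \<gamma>
    show "spin A (Min \<gamma>) * alt_sign \<gamma> (Min \<gamma>) \<in> {1, -1}"
      using spin_cases[of A "Min \<gamma>"] alt_sign_cases[of \<gamma> "Min \<gamma>"] by auto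
  qed
  have alt2: "alt_sign \<gamma> v * alt_sign \<gamma> v = 1" for \<gamma> v using alt_sign_cases[of \<gamma> v] by auto
  show "restrict (\<lambda>\<gamma>. spin (spins \<epsilon>) (Min \<gamma>) * alt_sign \<gamma> (Min \<gamma>)) C = \<epsilon>" if "\<epsilon> \<in> C \<rightarrow>\<^sub>E {1, -1}" for \<epsilon>
  proof (rule extensionalityI[of _ C])
    show "restrict (\<lambda>\<gamma>. spin (spins \<epsilon>) (Min \<gamma>) * alt_sign \<gamma> (Min \<gamma>)) C \<gamma> = \<epsilon> \<gamma>" if "\<gamma> \<in> C" for \<gamma>
      using spin_spins[OF \<open>\<epsilon> \<in> _\<close> that Min[OF that]] that alt2 by (simp add: mult.assoc)
  qed (use that in \<open>auto simp: PiE_def\<close>)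
  show "spins (restrict (\<lambda>\<gamma>. spin A (Min \<gamma>) * alt_sign \<gamma> (Min \<gamma>)) C) = A" if A: "A \<in> compats" for A
  proof -
    let ?e = "restrict (\<lambda>\<gamma>. spin A (Min \<gamma>) * alt_sign \<gamma> (Min \<gamma>)) C"
    have "v \<in> spins ?e \<longleftrightarrow> v \<in> A" if v: "v < N" for v
    proof -
      obtain \<gamma> where \<gamma>: "\<gamma> \<in> C" "v \<in> \<gamma>" by (rule component_exists[OF v])
      have "v \<in> spins ?e \<longleftrightarrow> ?e \<gamma> * alt_sign \<gamma> v = 1"
        using component_unique \<gamma> by (auto simp: spins_def)
      also have "\<dots> \<longleftrightarrow> spin A v * alt_sign \<gamma> v * alt_sign \<gamma> v = 1"
        using spin_component[OF A \<gamma>(1) Min[OF \<gamma>(1)] \<gamma>(2)] \<gamma>(1) by simp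
      also have "\<dots> \<longleftrightarrow> v \<in> A" using alt2[of \<gamma> v] by (simp add: mult.assoc spin_def)
      finally show ?thesis .
    qed
    moreover have "A \<subseteq> {..<N}" "spins ?e \<subseteq> {..<N}" using A C_subset by (auto simp: compats_def spins_def)
    ultimately show ?thesis by blast
  qed
qed

text \<open>The two half-turn exponents of a curve add up to 4 or -4 by
  \<open>turning_number\<close>, and its crossings with the two paths reduce to parities, so the
  weight becomes local to the curves.\<close>

lemma state_weight_mult_spins:
  assumes \<epsilon>: "\<epsilon> \<in> C \<rightarrow>\<^sub>E {1, -1}" and nz: "\<rho> \<noteq> 0" "\<alpha> \<noteq> 0" "\<beta> \<noteq> 0" and g: "g1 < N" "g2 < N"
  shows "state_weight \<rho> \<alpha> N f1 g1 (spins \<epsilon>) * state_weight \<rho> \<beta> N f2 g2 (spins \<epsilon>) =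
    (\<Prod>\<gamma>\<in>C. \<rho> powi (4 * \<epsilon> \<gamma>) * \<alpha> powi (\<epsilon> \<gamma> * (if odd (card {v \<in> \<gamma>. v \<le> g1}) then 1 else 0))
       * \<beta> powi (\<epsilon> \<gamma> * (if odd (card {v \<in> \<gamma>. v \<le> g2}) then 1 else 0)))"
proof -
  let ?A = "spins \<epsilon>"
  have comp: "compat N f1 ?A" "compat N f2 ?A"
    using bij_betwE[OF bij_spins] \<epsilon> by (auto simp: compats_def)
  have turn: "(\<Sum>v<N. spin ?A v * arc_dir f1 v) + (\<Sum>v<N. spin ?A v * arc_dir f2 v) = (\<Sum>\<gamma>\<in>C. 4 * \<epsilon> \<gamma>)"
  proof -
    have "(\<Sum>v\<in>\<gamma>. spin ?A v * arc_dir f1 v) + (\<Sum>v\<in>\<gamma>. spin ?A v * arc_dir f2 v) = 4 * \<epsilon> \<gamma>" if "\<gamma> \<in> C" for \<gamma>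
    proof -
      have *: "(\<Sum>v\<in>\<gamma>. spin ?A v * arc_dir f v) = \<epsilon> \<gamma> * (\<Sum>v\<in>\<gamma>. alt_sign \<gamma> v * arc_dir f v)" for f
        unfolding sum_distrib_left using spin_spins[OF \<epsilon> that] by (intro sum.cong) auto
      have "(\<Sum>v\<in>\<gamma>. alt_sign \<gamma> v * arc_dir f1 v) + (\<Sum>v\<in>\<gamma>. alt_sign \<gamma> v * arc_dir f2 v) = 4"
        by (rule turning_number[OF finite_component[OF that] nonempty_C[OF that] nc_component[OF that]])
          (use connected_C[OF that] in blast)
      then show ?thesis unfolding * by (metis distrib_left mult.commute)
    qed
    then show ?thesis unfolding sum_components sum.distrib[symmetric] by simp
  qed
  have prefix: "(\<Sum>v\<le>g. spin ?A v) = (\<Sum>\<gamma>\<in>C. \<epsilon> \<gamma> * (if odd (card {v \<in> \<gamma>. v \<le> g}) then 1 else 0))" if "g < N" for g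
  proof -
    have "(\<Sum>v\<le>g. spin ?A v) = (\<Sum>v<N. if v \<le> g then spin ?A v else 0)"
      using that by (intro sum.mono_neutral_cong_left) auto
    also have "\<dots> = (\<Sum>\<gamma>\<in>C. \<Sum>v\<in>\<gamma>. if v \<le> g then spin ?A v else 0)" by (rule sum_components)
    also have "\<dots> = (\<Sum>\<gamma>\<in>C. \<epsilon> \<gamma> * (if odd (card {v \<in> \<gamma>. v \<le> g}) then 1 else 0))"
    proof (intro sum.cong refl)
      fix \<gamma> assume \<gamma>: "\<gamma> \<in> C"
      have "(\<Sum>v\<in>\<gamma>. if v \<le> g then spin ?A v else 0) = (\<Sum>v\<in>{v \<in> \<gamma>. v \<le> g}. spin ?A v)"
        using finite_component[OF \<gamma>] by (simp add: sum.inter_filter)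
      also have "\<dots> = \<epsilon> \<gamma> * (\<Sum>v\<in>{v \<in> \<gamma>. v \<le> g}. alt_sign \<gamma> v)"
        unfolding sum_distrib_left using spin_spins[OF \<epsilon> \<gamma>] by (intro sum.cong) auto
      finally show "(\<Sum>v\<in>\<gamma>. if v \<le> g then spin ?A v else 0) = \<epsilon> \<gamma> * (if odd (card {v \<in> \<gamma>. v \<le> g}) then 1 else 0)"
        unfolding alt_sign_prefix_sum[OF finite_component[OF \<gamma>]] .
    qed
    finally show ?thesis .
  qed
  have "state_weight \<rho> \<alpha> N f1 g1 ?A * state_weight \<rho> \<beta> N f2 g2 ?A =
      \<rho> powi ((\<Sum>v<N. spin ?A v * arc_dir f1 v) + (\<Sum>v<N. spin ?A v * arc_dir f2 v))
      * \<alpha> powi (\<Sum>v\<le>g1. spin ?A v) * \<beta> powi (\<Sum>v\<le>g2. spin ?A v)"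
    using comp nz by (simp add: state_weight_def power_int_add mult_ac)
  then show ?thesis
    unfolding turn prefix[OF g(1)] prefix[OF g(2)] by (simp add: power_int_sum nz prod.distrib)
qed

text \<open>The sum over independent orientations is a product over the curves. A curve crossing
  neither path oddly gives \<open>\<rho> ^ 4\<close> plus its inverse. One crossing both oddly gives
  the same with the two terms interchanged, because \<open>\<alpha> * \<beta>\<close> is
  \<open>\<rho>\<close> to the -8. One crossing exactly one path oddly gives
  \<open>\<alpha> * \<rho> ^ 4\<close> plus its inverse, whichever path it is.\<close>

lemma sum_state_weight_mult:
  assumes N: "N = 2 * n" and nz: "\<rho> \<noteq> 0" "\<alpha> \<noteq> 0" and \<beta>: "\<alpha> * \<beta> = \<rho> powi (-8)" and g: "g1 < N" "g2 < N"
  shows "(\<Sum>A | A \<subseteq> {..<N} \<and> card A = n. state_weight \<rho> \<alpha> N f1 g1 A * state_weight \<rho> \<beta> N f2 g2 A) =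
    (\<Prod>\<gamma>\<in>C. if odd (card {v \<in> \<gamma>. v \<le> g1}) \<noteq> odd (card {v \<in> \<gamma>. v \<le> g2})
       then \<alpha> * \<rho> ^ 4 + inverse (\<alpha> * \<rho> ^ 4) else \<rho> ^ 4 + inverse (\<rho> ^ 4))" (is "_ = (\<Prod>\<gamma>\<in>C. ?c \<gamma>)")
proof -
  let ?W = "\<lambda>\<gamma> \<sigma>. \<rho> powi (4 * \<sigma>) * \<alpha> powi (\<sigma> * (if odd (card {v \<in> \<gamma>. v \<le> g1}) then 1 else 0))
       * \<beta> powi (\<sigma> * (if odd (card {v \<in> \<gamma>. v \<le> g2}) then 1 else 0))"
  have \<beta>': "\<beta> = inverse \<alpha> * inverse (\<rho> ^ 8)"
    using \<beta> nz by (simp add: field_simps power_int_minus)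
  have "(\<Sum>A | A \<subseteq> {..<N} \<and> card A = n. state_weight \<rho> \<alpha> N f1 g1 A * state_weight \<rho> \<beta> N f2 g2 A)
      = (\<Sum>A\<in>compats. state_weight \<rho> \<alpha> N f1 g1 A * state_weight \<rho> \<beta> N f2 g2 A)"
  proof (rule sum.mono_neutral_right)
    show "compats \<subseteq> {A. A \<subseteq> {..<N} \<and> card A = n}"
      using compat_card[OF f1[unfolded N]] unfolding compats_def N[symmetric] by auto
  qed (auto simp: compats_def state_weight_def)
  also have "\<dots> = (\<Sum>\<epsilon>\<in>C \<rightarrow>\<^sub>E {1, -1}. state_weight \<rho> \<alpha> N f1 g1 (spins \<epsilon>) * state_weight \<rho> \<beta> N f2 g2 (spins \<epsilon>))"
    by (rule sum.reindex_bij_betw[OF bij_spins, symmetric])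
  also have "\<dots> = (\<Sum>\<epsilon>\<in>C \<rightarrow>\<^sub>E {1, -1}. \<Prod>\<gamma>\<in>C. ?W \<gamma> (\<epsilon> \<gamma>))"
    using nz \<beta>' g by (intro sum.cong refl state_weight_mult_spins) auto
  also have "\<dots> = (\<Prod>\<gamma>\<in>C. \<Sum>\<sigma>\<in>{1, -1}. ?W \<gamma> \<sigma>)"
    using finite_C by (intro prod_sum_PiE[symmetric]) auto
  also have "\<dots> = (\<Prod>\<gamma>\<in>C. ?c \<gamma>)"
  proof (intro prod.cong refl)
    fix \<gamma>
    have "\<rho> ^ 8 = \<rho> ^ 4 * \<rho> ^ 4" by (simp flip: power_add)
    then show "(\<Sum>\<sigma>\<in>{1, -1}. ?W \<gamma> \<sigma>) = ?c \<gamma>"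
      using nz by (simp add: \<beta>' power_int_minus field_simps)
  qed
  finally show ?thesis .
qed

end

section \<open>Crossingless connections\<close>

definition mate :: "nat set set \<Rightarrow> nat \<Rightarrow> nat" where
  "mate M p = (THE q. {p, q} \<in> M)"

lemma NC_arcE:
  assumes "M \<in> NC n" "a \<in> M"
  obtains p q where "a = {p, q}" "p < q" "q < 2 * n"
proof -
  have "\<exists>p q. a = {p, q} \<and> p < q \<and> q < 2 * n"
    using assms by (simp add: NC_def perfect_matching_def)
  then show ?thesis using that by (elim exE conjE)
qed

lemma NC_ex1:
  assumes "M \<in> NC n" "p < 2 * n"
  shows "\<exists>!a. a \<in> M \<and> p \<in> a"
  using assms by (simp add: NC_def perfect_matching_def)

lemma NC_noncrossing:
  assumes "M \<in> NC n" "{p, q} \<in> M" "{r, s} \<in> M"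
  shows "\<not> (p < r \<and> r < q \<and> q < s)"
proof -
  have "noncrossing M" using assms(1) by (simp add: NC_def)
  then show ?thesis using assms(2,3) by (simp add: noncrossing_def)
qed

lemma NC_arc_lt:
  assumes "M \<in> NC n" "{p, q} \<in> M"
  shows "p < 2 * n" "q < 2 * n" "p \<noteq> q"
proof -
  obtain a b where "{p, q} = {a, b}" "a < b" "b < 2 * n"
    by (rule NC_arcE[OF assms])
  then show "p < 2 * n" "q < 2 * n" "p \<noteq> q" by (auto simp: doubleton_eq_iff)
qed

lemma NC_mate_exists:
  assumes M: "M \<in> NC n" and p: "p < 2 * n"
  shows "\<exists>!q. {p, q} \<in> M"
proof -
  obtain a where a: "a \<in> M" "p \<in> a" and uniq: "\<And>b. b \<in> M \<Longrightarrow> p \<in> b \<Longrightarrow> b = a"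
    using NC_ex1[OF M p] by (metis (no_types))
  obtain u v where uv: "a = {u, v}" by (rule NC_arcE[OF M a(1)])
  then have "\<exists>q. {p, q} \<in> M" using a by (auto simp: insert_commute)
  moreover have "q = q'" if "{p, q} \<in> M" "{p, q'} \<in> M" for q q'
    using uniq[OF that(1)] uniq[OF that(2)] by (auto simp: doubleton_eq_iff)
  ultimately show ?thesis by blast
qed

lemma arc_iff_mate:
  assumes "M \<in> NC n"
  shows "{p, q} \<in> M \<longleftrightarrow> p < 2 * n \<and> q = mate M p"
  using NC_mate_exists[OF assms] NC_arc_lt(1)[OF assms] unfolding mate_def by (metis (mono_tags, lifting) theI')

lemma nc_involution_mate:
  assumes M: "M \<in> NC n"
  shows "nc_involution {..<2 * n} (mate M)"
proof -
  let ?f = "mate M"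
  have arc: "{p, ?f p} \<in> M" if "p < 2 * n" for p using arc_iff_mate[OF M] that by blast
  have inv: "?f p < 2 * n" "?f p \<noteq> p" "?f (?f p) = p" if "p < 2 * n" for p
    using NC_arc_lt[OF M arc[OF that]] arc_iff_mate[OF M, of "?f p" p] arc[OF that]
    by (auto simp: insert_commute)
  have nc: "\<not> (p < r \<and> r < q \<and> q < s)" if "{p, q} \<in> M" "{r, s} \<in> M" for p q r s
    using NC_noncrossing[OF M that] .
  have "((p < r) = (?f p < r)) = ((p < ?f r) = (?f p < ?f r))"
    if p: "p < 2 * n" and r: "r < 2 * n" "r \<noteq> p" "r \<noteq> ?f p" for p r
  proof -
    define q s where "q = ?f p" and "s = ?f r"
    have M': "{p, q} \<in> M" "{r, s} \<in> M" using arc[OF p] arc[OF r(1)] by (simp_all add: q_def s_def)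
    have sp: "s \<noteq> p" and sq: "s \<noteq> q" using inv[OF r(1)] inv[OF p] r by (metis q_def s_def)+
    \<comment> \<open>\<open>noncrossing\<close> forbids one order pattern. Applied to the two arcs
      in either order and with either naming of their ends, it shows that an arc with one end
      beneath another arc has both ends there.\<close>
    have key: "(p < b) \<noteq> (q < b)" if b: "(p < a) \<noteq> (q < a)" "a \<noteq> p" "a \<noteq> q" "b \<noteq> p" "b \<noteq> q" "{a, b} \<in> M" for a b
    proof -
      have swap: "{q, p} \<in> M" "{b, a} \<in> M" using M' b by (simp_all add: insert_commute)
      show ?thesis
      proof (cases "p < a")
        case True
        then have "a < q" using b by linarith
        then show ?thesis using nc[OF M'(1) b(6)] nc[OF swap(2) M'(1)] True b by auto
      next
        case False
        then have "q < a" "a < p" using b by linarith+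
        then show ?thesis using nc[OF swap(1) b(6)] nc[OF swap(2) swap(1)] b by auto
      qed
    qed
    have "{s, r} \<in> M" using M'(2) by (simp add: insert_commute)
    then show ?thesis
      using key[of r s] key[of s r] M'(2) sp sq r(2,3) unfolding q_def[symmetric] s_def[symmetric] by blast
  qed
  then show ?thesis unfolding nc_involution_def using inv by simp
qed

lemma NC_arc_cases:
  assumes M: "M \<in> NC n" and a: "a \<in> M"
  obtains p where "p < 2 * n" "p < mate M p" "a = {p, mate M p}" "Min a = p" "Max a = mate M p"
proof -
  obtain p q where pq: "a = {p, q}" "p < q" by (rule NC_arcE[OF assms])
  then have "p < 2 * n" "q = mate M p" using arc_iff_mate[OF M] a by auto
  then show ?thesis using pq by (intro that[of p]) auto
qed

lemma meander_curves:
  assumes M1: "arcs_of m1 \<in> NC n" and M2: "arcs_of m2 \<in> NC n"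
  shows "meander (2 * n) (mate (arcs_of m1)) (mate (arcs_of m2)) (curves n m1 m2)"
proof -
  let ?f1 = "mate (arcs_of m1)" and ?f2 = "mate (arcs_of m2)"
  define E where "E = {(p, q). {p, q} \<in> arcs_of m1 \<union> arcs_of m2}"
  have E_iff: "(p, q) \<in> E \<longleftrightarrow> p < 2 * n \<and> (q = ?f1 p \<or> q = ?f2 p)" for p q
    using arc_iff_mate[OF M1] arc_iff_mate[OF M2] by (auto simp: E_def)
  have "sym E" by (auto simp: E_def sym_def insert_commute)
  then have sym: "sym (E\<^sup>*)" by (rule sym_rtrancl)
  have E_lt: "q < 2 * n" if "(p, q) \<in> E\<^sup>*" "p < 2 * n" for p q
    using that
  proof (induction rule: rtrancl_induct)
    case (step y z)
    then show ?case using NC_arc_lt(2)[OF M1] NC_arc_lt(2)[OF M2] by (auto simp: E_def)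
  qed
  have curves: "curves n m1 m2 = (\<lambda>x. E\<^sup>* `` {x}) ` {..<2 * n}"
    unfolding curves_def E_def[symmetric] quotient_def by auto
  show ?thesis
  proof
    show "nc_involution {..<2 * n} ?f1" "nc_involution {..<2 * n} ?f2"
      using nc_involution_mate M1 M2 by auto
    have curveE: "\<exists>x<2 * n. \<gamma> = E\<^sup>* `` {x}" if "\<gamma> \<in> curves n m1 m2" for \<gamma>
      using that unfolding curves by (simp add: image_iff Bex_def)
    show "\<Union>(curves n m1 m2) = {..<2 * n}"
    proof (intro equalityI subsetI)
      fix v assume "v \<in> \<Union>(curves n m1 m2)"
      then obtain \<gamma> where "\<gamma> \<in> curves n m1 m2" "v \<in> \<gamma>" by (elim UnionE)
      then show "v \<in> {..<2 * n}" using curveE[of \<gamma>] E_lt by fastforce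
    next
      fix v assume "v \<in> {..<2 * n}"
      then have "E\<^sup>* `` {v} \<in> curves n m1 m2" "v \<in> E\<^sup>* `` {v}" unfolding curves by simp_all
      then show "v \<in> \<Union>(curves n m1 m2)" by (rule UnionI)
    qed
    show "\<gamma> \<inter> \<gamma>' = {}" if \<gamma>: "\<gamma> \<in> curves n m1 m2" "\<gamma>' \<in> curves n m1 m2" "\<gamma> \<noteq> \<gamma>'" for \<gamma> \<gamma>'
    proof (rule ccontr)
      assume "\<gamma> \<inter> \<gamma>' \<noteq> {}"
      then obtain v where v: "v \<in> \<gamma>" "v \<in> \<gamma>'" by blast
      obtain x where x: "\<gamma> = E\<^sup>* `` {x}" using curveE[OF \<gamma>(1)] by (elim exE conjE)
      obtain y where y: "\<gamma>' = E\<^sup>* `` {y}" using curveE[OF \<gamma>(2)] by (elim exE conjE)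
      have xv: "(x, v) \<in> E\<^sup>*" "(y, v) \<in> E\<^sup>*" using v x y by simp_all
      have "(x, y) \<in> E\<^sup>*" "(y, x) \<in> E\<^sup>*"
        by (rule rtrancl_trans[OF xv(1) symD[OF sym xv(2)]], rule rtrancl_trans[OF xv(2) symD[OF sym xv(1)]])
      then have "\<gamma> = \<gamma>'" unfolding x y by (auto intro: rtrancl_trans)
      then show False using \<gamma>(3) by simp
    qed
    show "\<gamma> \<noteq> {}" if "\<gamma> \<in> curves n m1 m2" for \<gamma> using curveE[OF that] by auto
    show "?f1 v \<in> \<gamma> \<and> ?f2 v \<in> \<gamma>" if \<gamma>: "\<gamma> \<in> curves n m1 m2" and v: "v \<in> \<gamma>" for \<gamma> v
    proof -
      obtain x where x: "x < 2 * n" "\<gamma> = E\<^sup>* `` {x}" using curveE[OF \<gamma>] by (elim exE conjE)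
      have xv: "(x, v) \<in> E\<^sup>*" using v x by simp
      have "v < 2 * n" by (rule E_lt[OF xv x(1)])
      then have step: "(v, ?f1 v) \<in> E" "(v, ?f2 v) \<in> E" using E_iff by simp_all
      have "(x, ?f1 v) \<in> E\<^sup>*" "(x, ?f2 v) \<in> E\<^sup>*"
        using rtrancl_into_rtrancl[OF xv step(1)] rtrancl_into_rtrancl[OF xv step(2)] by simp_all
      then show ?thesis using x by simp
    qed
    show "Y = \<gamma>" if \<gamma>: "\<gamma> \<in> curves n m1 m2" and Y: "Y \<subseteq> \<gamma>" "Y \<noteq> {}"
      and cl: "\<And>v. v \<in> Y \<Longrightarrow> ?f1 v \<in> Y \<and> ?f2 v \<in> Y" for \<gamma> Y
    proof -
      obtain x where x: "\<gamma> = E\<^sup>* `` {x}" using curveE[OF \<gamma>] by (elim exE conjE)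
      obtain y where y: "y \<in> Y" using Y by blast
      have Yv: "v \<in> Y" if "(y, v) \<in> E\<^sup>*" for v
        using that
      proof (induction rule: rtrancl_induct)
        case base
        show ?case by (rule y)
      next
        case (step u v)
        then show ?case using cl[of u] E_iff[of u v] by auto
      qed
      have "v \<in> Y" if v: "v \<in> \<gamma>" for v
      proof -
        have xy: "(x, y) \<in> E\<^sup>*" "(x, v) \<in> E\<^sup>*" using subsetD[OF Y(1) y] v x by simp_all
        show ?thesis by (rule Yv[OF rtrancl_trans[OF symD[OF sym xy(1)] xy(2)]])
      qed
      then show ?thesis using Y(1) by blast
    qed
  qed
qed

section \<open>Parity of crossings and the entries of the Gram matrix\<close>

definition odd_upto :: "nat set \<Rightarrow> nat \<Rightarrow> bool" where
  "odd_upto \<gamma> g \<longleftrightarrow> odd (card {v \<in> \<gamma>. v \<le> g})"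

lemma odd_upto_neq_iff:
  assumes "finite \<gamma>" "g \<le> g'"
  shows "odd_upto \<gamma> g \<noteq> odd_upto \<gamma> g' \<longleftrightarrow> odd (card {v \<in> \<gamma>. g < v \<and> v \<le> g'})"
proof -
  have "{v \<in> \<gamma>. v \<le> g'} = {v \<in> \<gamma>. v \<le> g} \<union> {v \<in> \<gamma>. g < v \<and> v \<le> g'}" using assms by auto
  moreover have "card \<dots> = card {v \<in> \<gamma>. v \<le> g} + card {v \<in> \<gamma>. g < v \<and> v \<le> g'}"
    using assms by (intro card_Un_disjoint) auto
  ultimately have "card {v \<in> \<gamma>. v \<le> g'} = card {v \<in> \<gamma>. v \<le> g} + card {v \<in> \<gamma>. g < v \<and> v \<le> g'}" by simp
  then show ?thesis unfolding odd_upto_def by presburger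
qed

text \<open>Halving a doubled coordinate sends a gap to the point before it and a marked point to
  itself. In the latter case \<open>odd_upto\<close> would count the reference point, which is
  harmless because it does not lie on \<open>\<gamma>\<close>.\<close>

lemma separates_iff_odd_upto:
  assumes fin: "finite \<gamma>" and 1: "odd (ref_pos m1) \<or> ref_pos m1 div 2 \<notin> \<gamma>"
    and 2: "odd (ref_pos m2) \<or> ref_pos m2 div 2 \<notin> \<gamma>"
  shows "separates m1 m2 \<gamma> \<longleftrightarrow> odd_upto \<gamma> (ref_pos m1 div 2) \<noteq> odd_upto \<gamma> (ref_pos m2 div 2)"
proof -
  have *: "odd (card {v \<in> \<gamma>. r1 < 2 * v \<and> 2 * v < r2}) \<longleftrightarrow> odd_upto \<gamma> (r1 div 2) \<noteq> odd_upto \<gamma> (r2 div 2)"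
    if "r1 \<le> r2" "odd r2 \<or> r2 div 2 \<notin> \<gamma>" for r1 r2
  proof -
    have "{v \<in> \<gamma>. r1 < 2 * v \<and> 2 * v < r2} = {v \<in> \<gamma>. r1 div 2 < v \<and> v \<le> r2 div 2}"
    proof (intro Collect_cong conj_cong refl)
      fix v assume "v \<in> \<gamma>"
      show "r1 < 2 * v \<longleftrightarrow> r1 div 2 < v" by linarith
      have "v \<noteq> r2 div 2 \<or> odd r2" using that \<open>v \<in> \<gamma>\<close> by auto
      then show "2 * v < r2 \<longleftrightarrow> v \<le> r2 div 2" by presburger
    qed
    then show ?thesis using odd_upto_neq_iff[OF fin div_le_mono[OF that(1)]] by simp
  qed
  show ?thesis
    unfolding separates_def using *[of "ref_pos m1" "ref_pos m2"] *[of "ref_pos m2" "ref_pos m1"] 1 2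
    by (cases "ref_pos m1 \<le> ref_pos m2") (auto simp: min_def max_def)
qed

text \<open>No arc separates two gaps of one face, so the points of a closed curve between these
  gaps are paired among themselves by \<open>mate M\<close>.\<close>

lemma odd_upto_region:
  assumes M: "M \<in> NC n" and g: "g < 2 * n"
    and fin: "finite \<gamma>" and \<gamma>: "\<gamma> \<subseteq> {..<2 * n}" "\<And>v. v \<in> \<gamma> \<Longrightarrow> mate M v \<in> \<gamma>"
  shows "odd_upto \<gamma> (Min (region n M g)) = odd_upto \<gamma> g" "Min (region n M g) < 2 * n"
proof -
  let ?f = "mate M"
  have *: "odd_upto \<gamma> u = odd_upto \<gamma> w" if uw: "u \<le> w" and same: "\<And>a. a \<in> M \<Longrightarrow>
      (Min a \<le> u \<and> u < Max a) \<longleftrightarrow> (Min a \<le> w \<and> w < Max a)" for u w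
  proof -
    have "even (card {v \<in> \<gamma>. u < v \<and> v \<le> w})"
    proof (rule even_card_involution[of _ ?f])
      fix v assume v: "v \<in> {v \<in> \<gamma>. u < v \<and> v \<le> w}"
      then have vn: "v < 2 * n" using \<gamma> by auto
      note D = nc_involutionD[OF nc_involution_mate[OF M], of v]
      have "{v, ?f v} \<in> M" using arc_iff_mate[OF M] vn by blast
      from same[OF this] have "(min v (?f v) \<le> u \<and> u < max v (?f v)) \<longleftrightarrow> (min v (?f v) \<le> w \<and> w < max v (?f v))"
        by simp
      then have "u < ?f v \<and> ?f v \<le> w" using v D vn by (auto simp: min_def max_def split: if_splits)
      then show "?f v \<in> {v \<in> \<gamma>. u < v \<and> v \<le> w} \<and> ?f v \<noteq> v \<and> ?f (?f v) = v"
        using v \<gamma> D vn by auto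
    qed (use fin in auto)
    then show ?thesis using odd_upto_neq_iff[OF fin uw] by blast
  qed
  have "g \<in> region n M g" using g by (simp add: region_def)
  moreover have "finite (region n M g)" by (simp add: region_def)
  ultimately have m: "Min (region n M g) \<in> region n M g" "Min (region n M g) \<le> g"
    by (auto intro: Min_in)
  have reg: "u < 2 * n \<and> (\<forall>a\<in>M. (Min a \<le> g \<and> g < Max a) \<longleftrightarrow> (Min a \<le> u \<and> u < Max a))"
    if "u \<in> region n M g" for u
    using that by (simp add: region_def)
  show "Min (region n M g) < 2 * n" using reg[OF m(1)] by (rule conjunct1)
  show "odd_upto \<gamma> (Min (region n M g)) = odd_upto \<gamma> g"
  proof (rule *[OF m(2)])
    fix a assume "a \<in> M"
    then show "(Min a \<le> Min (region n M g) \<and> Min (region n M g) < Max a) \<longleftrightarrow> (Min a \<le> g \<and> g < Max a)"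
      using reg[OF m(1)] by blast
  qed
qed

text \<open>The gap after \<open>p\<close> is beneath the arc and the gap after
  \<open>mate M p\<close> is outside. Between them a curve has an even number of points strictly
  beneath the arc, and the end \<open>mate M p\<close> if it runs through the arc.\<close>

lemma odd_upto_arc:
  assumes M: "M \<in> NC n" and p: "p < 2 * n" "p < mate M p"
    and fin: "finite \<gamma>" and \<gamma>: "\<gamma> \<subseteq> {..<2 * n}" "\<And>v. v \<in> \<gamma> \<Longrightarrow> mate M v \<in> \<gamma>"
  shows "odd_upto \<gamma> p \<noteq> odd_upto \<gamma> (mate M p) \<longleftrightarrow> p \<in> \<gamma>"
proof -
  let ?f = "mate M"
  note f = nc_involution_mate[OF M]
  let ?B = "{v \<in> \<gamma>. p < v \<and> v < ?f p}"
  have B: "even (card ?B)" using even_between[OF f, of p \<gamma>] p fin \<gamma> by auto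
  have mem: "?f p \<in> \<gamma> \<longleftrightarrow> p \<in> \<gamma>" using \<gamma>(2) nc_involutionD(3)[OF f, of p] p by (metis lessThan_iff)
  have "odd (card {v \<in> \<gamma>. p < v \<and> v \<le> ?f p}) \<longleftrightarrow> p \<in> \<gamma>"
  proof (cases "p \<in> \<gamma>")
    case True
    then have "{v \<in> \<gamma>. p < v \<and> v \<le> ?f p} = insert (?f p) ?B" using mem p by auto
    moreover have "card \<dots> = Suc (card ?B)" using fin by (intro card_insert_disjoint) auto
    ultimately show ?thesis using B True by simp
  next
    case False
    then have "{v \<in> \<gamma>. p < v \<and> v \<le> ?f p} = ?B" using mem by (auto simp: le_less)
    then show ?thesis using B False by simp
  qed
  then show ?thesis using odd_upto_neq_iff[OF fin, of p "?f p"] p by simp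
qed

lemma poly_bilinear_Free_Free:
  assumes M: "M \<in> NC n" "M' \<in> NC n"
  shows "poly (ev d x y w (bilinear n (Free M R) (Free M' R'))) c =
    (\<Prod>\<gamma>\<in>curves n (Free M R) (Free M' R'). if odd_upto \<gamma> (Min R) \<noteq> odd_upto \<gamma> (Min R') then c else d)"
proof -
  interpret meander "2 * n" "mate M" "mate M'" "curves n (Free M R) (Free M' R')"
    using meander_curves[of "Free M R" n "Free M' R'"] M by simp
  show ?thesis
    unfolding bilinear_def ev.hom_prod poly_prod
    by (intro prod.cong refl) (simp add: curve_class_def separates_iff_odd_upto finite_component)
qed

text \<open>The faces at \<open>Min a\<close> and \<open>Max a\<close> are those on the two sides of
  the arc. Only the curve \<open>\<gamma>0\<close> through the arc tells the three rows apart: it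
  counts as \<open>x\<close> in the first, and as \<open>d\<close> and \<open>c\<close> in some
  order in the other two. All other curves contribute the common factor \<open>?P\<close>.\<close>

lemma poly_bilinear_Cap_Free:
  fixes R' :: "nat set"
  assumes M: "M \<in> NC n" "M' \<in> NC n" and a: "a \<in> M"
  shows "(d + c) * poly (ev d x y w (bilinear n (Cap M a) (Free M' R'))) c =
    x * (poly (ev d x y w (bilinear n (Free M (region n M (Min a))) (Free M' R'))) c
       + poly (ev d x y w (bilinear n (Free M (region n M (Max a))) (Free M' R'))) c)"
proof -
  define C where "C = curves n (Cap M a) (Free M' R')"
  have C': "curves n (Free M R) (Free M' R') = C" for R by (simp add: C_def curves_def)
  interpret meander "2 * n" "mate M" "mate M'" C
    unfolding C_def using meander_curves[of "Cap M a" n "Free M' R'"] M by simp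
  obtain p where p: "p < 2 * n" "p < mate M p" "a = {p, mate M p}" "Min a = p" "Max a = mate M p"
    using NC_arc_cases[OF M(1) a] .
  obtain \<gamma>0 where \<gamma>0: "\<gamma>0 \<in> C" "p \<in> \<gamma>0" by (rule component_exists[OF p(1)])
  have a_sub: "a \<subseteq> \<gamma> \<longleftrightarrow> p \<in> \<gamma>" if "\<gamma> \<in> C" for \<gamma> using closed_C[OF that] p(3) by auto
  have p_in: "p \<in> \<gamma> \<longleftrightarrow> \<gamma> = \<gamma>0" if "\<gamma> \<in> C" for \<gamma> using component_unique[OF that \<gamma>0(1)] \<gamma>0 by auto
  have p': "mate M p < 2 * n" using nc_involutionD(1)[OF f1, of p] p by simp
  let ?c = "\<lambda>\<gamma> g. if odd_upto \<gamma> g \<noteq> odd_upto \<gamma> (Min R') then c else d"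
  let ?P = "\<Prod>\<gamma>\<in>C - {\<gamma>0}. ?c \<gamma> p"
  have free: "poly (ev d x y w (bilinear n (Free M (region n M g)) (Free M' R'))) c = (\<Prod>\<gamma>\<in>C. ?c \<gamma> g)"
    if g: "g < 2 * n" for g
    unfolding poly_bilinear_Free_Free[OF M] C'
    using odd_upto_region(1)[OF M(1) g finite_component C_subset] closed_C by (intro prod.cong) auto
  have odd_upto: "odd_upto \<gamma> p \<noteq> odd_upto \<gamma> (mate M p) \<longleftrightarrow> \<gamma> = \<gamma>0" if "\<gamma> \<in> C" for \<gamma>
    using odd_upto_arc[OF M(1) p(1,2) finite_component[OF that] C_subset[OF that]] closed_C[OF that] p_in[OF that] by auto
  have 1: "(\<Prod>\<gamma>\<in>C. ?c \<gamma> p) = ?c \<gamma>0 p * ?P"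
    by (rule prod.remove[OF finite_C \<gamma>0(1)])
  have 2: "(\<Prod>\<gamma>\<in>C. ?c \<gamma> (mate M p)) = ?c \<gamma>0 (mate M p) * ?P"
  proof -
    have same: "odd_upto \<gamma> (mate M p) = odd_upto \<gamma> p" if "\<gamma> \<in> C - {\<gamma>0}" for \<gamma> using odd_upto[of \<gamma>] that by blast
    have "(\<Prod>\<gamma>\<in>C - {\<gamma>0}. ?c \<gamma> (mate M p)) = ?P" by (intro prod.cong refl) (simp add: same)
    then show ?thesis using prod.remove[OF finite_C \<gamma>0(1), of "\<lambda>\<gamma>. ?c \<gamma> (mate M p)"] by (simp only:)
  qed
  have 3: "?c \<gamma>0 p + ?c \<gamma>0 (mate M p) = d + c" using odd_upto[OF \<gamma>0(1)] by auto
  have 4: "poly (ev d x y w (bilinear n (Cap M a) (Free M' R'))) c = x * ?P"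
  proof -
    have "poly (ev d x y w (bilinear n (Cap M a) (Free M' R'))) c
        = (\<Prod>\<gamma>\<in>C. if \<gamma> = \<gamma>0 then x else ?c \<gamma> p)"
      unfolding bilinear_def ev.hom_prod poly_prod C_def[symmetric]
    proof (intro prod.cong refl)
      fix \<gamma> assume \<gamma>: "\<gamma> \<in> C"
      have "separates (Cap M a) (Free M' R') \<gamma> \<longleftrightarrow> odd_upto \<gamma> p \<noteq> odd_upto \<gamma> (Min R')" if "\<gamma> \<noteq> \<gamma>0"
        using separates_iff_odd_upto[OF finite_component[OF \<gamma>], of "Cap M a" "Free M' R'"] that p_in[OF \<gamma>] p(4) by simp
      then show "poly (ev d x y w (curve_class (Cap M a) (Free M' R') \<gamma>)) c = (if \<gamma> = \<gamma>0 then x else ?c \<gamma> p)"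
        using a_sub[OF \<gamma>] p_in[OF \<gamma>] by (auto simp: curve_class_def)
    qed
    also have "\<dots> = x * ?P"
      by (subst prod.remove[OF finite_C \<gamma>0(1)]) (auto intro!: prod.cong)
    finally show ?thesis .
  qed
  show ?thesis
    unfolding p(4,5) free[OF p(1)] free[OF p'] 1 2 4 distrib_right[symmetric] 3 by simp
qed

section \<open>Finiteness and size of the index sets\<close>

lemma NC_arc_subset:
  assumes "M \<in> NC n" "a \<in> M"
  shows "a \<subseteq> {..<2 * n}"
  using NC_arcE[OF assms] by (metis insert_subset empty_subsetI lessThan_iff less_trans)

lemma finite_NC: "finite (NC n)"
proof (rule finite_subset)
  show "NC n \<subseteq> Pow (Pow {..<2 * n})"
    using NC_arc_subset by blast
qed simp

lemma finite_Mb_1: "finite (Mb_1 n)"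
proof -
  have "Mb0 n \<subseteq> (\<lambda>(M, R). Free M R) ` (NC n \<times> Pow {..<2 * n})"
    by (auto simp: Mb0_def region_def)
  then have "finite (Mb0 n)" using finite_NC finite_subset by blast
  moreover have "Mb1 n = (\<lambda>(M, a). Cap M a) ` (SIGMA M:NC n. M)" by (auto simp: Mb1_def)
  moreover have "finite M" if "M \<in> NC n" for M
  proof (rule finite_subset)
    show "M \<subseteq> Pow {..<2 * n}" using NC_arc_subset[OF that] by blast
  qed simp
  ultimately show ?thesis using finite_NC by (simp add: Mb_1_def)
qed

lemma NC_of_involution:
  assumes f: "nc_involution {..<2 * n} f"
  shows "(\<lambda>p. {p, f p}) ` {..<2 * n} \<in> NC n" (is "?M \<in> _")
proof -
  note D = nc_involutionD[OF f]
  have arcD: "p < 2 * n \<and> q = f p" if pq: "{p, q} \<in> ?M" for p q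
  proof -
    obtain r where r: "r < 2 * n" "{p, q} = {r, f r}" using pq by auto
    then show ?thesis using D[of r] by (auto simp: doubleton_eq_iff)
  qed
  have "perfect_matching n ?M"
    unfolding perfect_matching_def
  proof (intro conjI ballI allI impI)
    fix a assume "a \<in> ?M"
    then obtain r where r: "r < 2 * n" "a = {r, f r}" by auto
    have "a = {min r (f r), max r (f r)} \<and> min r (f r) < max r (f r) \<and> max r (f r) < 2 * n"
      using D[of r] r by (auto simp: min_def max_def)
    then show "\<exists>p q. a = {p, q} \<and> p < q \<and> q < 2 * n" by blast
  next
    fix p assume p: "p < 2 * n"
    show "\<exists>!a. a \<in> ?M \<and> p \<in> a"
    proof (rule ex1I[of _ "{p, f p}"])
      fix a assume a: "a \<in> ?M \<and> p \<in> a"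
      then obtain r where "r < 2 * n" "a = {r, f r}" by auto
      then obtain q where q: "a = {p, q}" using a by (auto simp: insert_commute)
      then have "q = f p" using arcD[of p q] a by simp
      then show "a = {p, f p}" using q by simp
    qed (use p in auto)
  qed
  moreover have "noncrossing ?M"
    unfolding noncrossing_def
  proof (intro allI impI notI)
    fix p q r s assume a: "{p, q} \<in> ?M" "{r, s} \<in> ?M" and c: "p < r \<and> r < q \<and> q < s"
    have "p < 2 * n" "q = f p" "r < 2 * n" "s = f r" using arcD[OF a(1)] arcD[OF a(2)] by simp_all
    then show False using D(4)[of p r] c by auto
  qed
  ultimately show ?thesis by (simp add: NC_def)
qed

text \<open>Cyclic bracket matching turns a balanced set into a diagram with a distinguished face,
  and the set is recovered from these two data, so the assignment is injective.\<close>

lemma card_Mb0_ge: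
  assumes "n \<ge> 1"
  shows "card {A. A \<subseteq> {..<2 * n} \<and> card A = n} \<le> card (Mb0 n)"
proof -
  let ?\<Sigma> = "{A. A \<subseteq> {..<2 * n} \<and> card A = n}"
  define arcs where "arcs f = (\<lambda>p. {p, f p}) ` {..<2 * n}" for f :: "nat \<Rightarrow> nat"
  \<comment> \<open>Inverse of the matching: the left end of an arc belongs to the set iff the arc
    does not cover the gap, and the right end iff it does. Only the face of the gap matters
    here.\<close>
  define up where "up M g = {v \<in> {..<2 * n}. \<exists>a\<in>M. v \<in> a \<and> (v = Min a) \<noteq> (Min a \<le> g \<and> g < Max a)}"
    for M :: "nat set set" and g
  have "\<exists>M g. M \<in> NC n \<and> g < 2 * n \<and> A = up M g" if A: "A \<in> ?\<Sigma>" for A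
  proof -
    obtain f g where f: "nc_involution {..<2 * n} f" and g: "g < 2 * n"
      and ori: "\<And>p. p < 2 * n \<Longrightarrow> p < f p \<Longrightarrow> (p \<in> A \<longleftrightarrow> \<not> (p \<le> g \<and> g < f p)) \<and> (f p \<in> A \<longleftrightarrow> p \<notin> A)"
    proof -
      have A': "finite {..<2 * n}" "A \<subseteq> {..<2 * n}" "2 * card A = card {..<2 * n}" "0 \<in> {..<2 * n}"
        using A assms by simp_all
      obtain f g where fg: "nc_involution {..<2 * n} f" "{..<2 * n} \<noteq> {} \<longrightarrow> g \<in> {..<2 * n}"
        "\<forall>p\<in>{..<2 * n}. p < f p \<longrightarrow> (p \<in> A \<longleftrightarrow> \<not> (p \<le> g \<and> g < f p)) \<and> (f p \<in> A \<longleftrightarrow> p \<notin> A)"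
        using exists_nc_involution_orientation[OF A'(1-3)] by (elim exE conjE)
      have "g \<in> {..<2 * n}" using fg(2) A'(4) by blast
      then show ?thesis using fg(1,3) by (intro that[of f g]) simp_all
    qed
    note D = nc_involutionD[OF f]
    have "v \<in> A \<longleftrightarrow> v \<in> up (arcs f) g" if v: "v < 2 * n" for v
    proof -
      have uniq: "a = {v, f v}" if a: "a \<in> arcs f" "v \<in> a" for a
      proof -
        obtain r where r: "r < 2 * n" "a = {r, f r}" using a(1) unfolding arcs_def by (elim imageE) simp
        then have "f (f r) = r" using D(3)[of r] by simp
        then show ?thesis using r a(2) by auto
      qed
      have mem: "{v, f v} \<in> arcs f" using v by (auto simp: arcs_def)
      have "(\<exists>a\<in>arcs f. v \<in> a \<and> Q a) \<longleftrightarrow> Q {v, f v}" for Q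
        using uniq mem by (metis insertI1)
      then have up: "v \<in> up (arcs f) g \<longleftrightarrow>
          (v = min v (f v)) \<noteq> (min v (f v) \<le> g \<and> g < max v (f v))"
        unfolding up_def using v by simp
      show ?thesis
      proof (cases "v < f v")
        case True
        then show ?thesis using up ori[OF v True] by (simp add: min_def max_def)
      next
        case False
        then have lt: "f v < v" "f v < 2 * n" "f (f v) = v" using D[of v] v by auto
        then show ?thesis using up ori[of "f v"] by (simp add: min_def max_def)
      qed
    qed
    then have "A = up (arcs f) g" using A by (auto simp: up_def)
    then show ?thesis using NC_of_involution[OF f] g unfolding arcs_def by blast
  qed
  then have "\<forall>A\<in>?\<Sigma>. \<exists>Mg. fst Mg \<in> NC n \<and> snd Mg < 2 * n \<and> A = up (fst Mg) (snd Mg)" by simp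
  then have "\<exists>Mg. \<forall>A\<in>?\<Sigma>. fst (Mg A) \<in> NC n \<and> snd (Mg A) < 2 * n \<and> A = up (fst (Mg A)) (snd (Mg A))"
    by (rule bchoice)
  then obtain Mg where Mg: "\<forall>A\<in>?\<Sigma>. fst (Mg A) \<in> NC n \<and> snd (Mg A) < 2 * n \<and> A = up (fst (Mg A)) (snd (Mg A))"
    by (elim exE)
  define M where "M A = fst (Mg A)" for A
  define g where "g A = snd (Mg A)" for A
  have M: "M A \<in> NC n" and g: "g A < 2 * n" and up: "up (M A) (g A) = A" if "A \<in> ?\<Sigma>" for A
    using bspec[OF Mg that] by (simp_all add: M_def g_def)
  have "inj_on (\<lambda>A. Free (M A) (region n (M A) (g A))) ?\<Sigma>"
  proof (rule inj_onI)
    fix A B assume A: "A \<in> ?\<Sigma>" and B: "B \<in> ?\<Sigma>"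
      and eq: "Free (M A) (region n (M A) (g A)) = Free (M B) (region n (M B) (g B))"
    have "g B \<in> region n (M B) (g B)" using g[OF B] by (simp add: region_def)
    moreover have MAB: "M A = M B" and reg: "region n (M A) (g A) = region n (M B) (g B)"
      by (rule conjunct1[OF eq[unfolded conn.inject]], rule conjunct2[OF eq[unfolded conn.inject]])
    ultimately have "g B \<in> region n (M A) (g A)" unfolding reg by blast
    then have same: "(Min a \<le> g A \<and> g A < Max a) \<longleftrightarrow> (Min a \<le> g B \<and> g B < Max a)" if "a \<in> M A" for a
      using that by (simp add: region_def)
    have bex: "(\<exists>a\<in>M A. v \<in> a \<and> (v = Min a) \<noteq> (Min a \<le> g A \<and> g A < Max a)) \<longleftrightarrow>
        (\<exists>a\<in>M A. v \<in> a \<and> (v = Min a) \<noteq> (Min a \<le> g B \<and> g B < Max a))" for v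
      by (intro bex_cong refl) (simp only: same)
    have "A = up (M A) (g A)" by (rule up[OF A, symmetric])
    also have "\<dots> = up (M A) (g B)" unfolding up_def by (simp only: bex)
    also have "\<dots> = up (M B) (g B)" by (simp only: MAB)
    also have "\<dots> = B" by (rule up[OF B])
    finally show "A = B" .
  qed
  moreover have "(\<lambda>A. Free (M A) (region n (M A) (g A))) ` ?\<Sigma> \<subseteq> Mb0 n"
  proof (rule image_subsetI)
    fix A assume "A \<in> ?\<Sigma>"
    from M[OF this] g[OF this] show "Free (M A) (region n (M A) (g A)) \<in> Mb0 n"
      unfolding Mb0_def mem_Collect_eq by (intro exI[of _ "M A"] exI[of _ "g A"]) simp
  qed
  moreover have "finite (Mb0 n)" using finite_Mb_1[of n] by (simp add: Mb_1_def)
  ultimately show ?thesis by (rule card_inj_on_le)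
qed

section \<open>Divisibility of the Gram determinant\<close>

lemma add_inverse_strict_mono:
  fixes a b :: real
  assumes "0 < a" "a < b" "1 < a * b"
  shows "a + inverse a < b + inverse b"
proof -
  have "0 < (b - a) * (1 - inverse (a * b))"
    using assms by (intro mult_pos_pos) (simp_all add: inverse_less_1_iff del: inverse_mult_distrib)
  also have "\<dots> = (b + inverse b) - (a + inverse a)"
    using assms by (simp add: field_simps)
  finally show ?thesis by simp
qed

lemma add_inverse_inj:
  fixes a b :: real
  assumes "0 < a" "0 < b" "1 < a * b" "a + inverse a = b + inverse b"
  shows "a = b"
  using add_inverse_strict_mono[of a b] add_inverse_strict_mono[of b a] assms
  by (metis linorder_less_linear mult.commute order_less_irrefl)

text \<open>\<open>c\<close> is the root in z of T_k(d) + (-1)^k z, since T_k(q + 1/q) = q^k +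
  q^(-k).\<close>

lemma linear_power_dvd_gram_det:
  fixes n k :: nat and \<rho> x y w :: real
  assumes n: "n \<ge> 1" and k: "1 \<le> k" "k \<le> n" and \<rho>: "\<rho> > 1"
    and ind: "\<forall>b. (\<forall>A\<in>{A. A \<subseteq> {..<2 * n} \<and> card A = n}.
        (\<Sum>t\<in>{t. t \<subseteq> {..<2 * n} \<and> card t = n + k}. b t * kernel_vec \<rho> t A) = 0)
      \<longrightarrow> (\<forall>t\<in>{t. t \<subseteq> {..<2 * n} \<and> card t = n + k}. b t = 0)"
  defines "q \<equiv> \<rho> ^ 4"
  defines "c \<equiv> - ((-1) ^ k) * (q ^ k + inverse (q ^ k))"
  shows "[:-c, 1:] ^ (2 * n choose (n - k)) dvd ev (q + inverse q) x y w (gram_det_Mb1 n)"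
proof -
  define d where "d = q + inverse q"
  \<comment> \<open>The sign of u: \<open>c\<close> is u + 1/u for u =
    \<open>\<zeta> * q ^ k\<close>, and u has to be \<open>\<alpha> * \<rho> ^ 4\<close> by the
    state sum.\<close>
  define \<zeta> :: real where "\<zeta> = - ((-1) ^ k)"
  \<comment> \<open>\<open>\<alpha> * \<beta>\<close> = q^(-2) reverses the turning of curves that enclose both crosscaps, so they count as d.\<close>
  define \<alpha> where "\<alpha> = \<zeta> * q ^ (k - 1)"
  define \<beta> where "\<beta> = \<rho> powi (-8) / \<alpha>"
  let ?\<Sigma> = "{A. A \<subseteq> {..<2 * n} \<and> card A = n}"
  let ?T = "{t. t \<subseteq> {..<2 * n} \<and> card t = n + k}"
  have q1: "q > 1" using \<rho> by (simp add: q_def)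
  have \<zeta>: "\<zeta> * \<zeta> = 1" "\<zeta> \<noteq> 0" "inverse \<zeta> = \<zeta>" by (auto simp: \<zeta>_def minus_one_power_iff)
  have nz: "\<rho> \<noteq> 0" "\<alpha> \<noteq> 0" using \<rho> \<zeta> by (auto simp: \<alpha>_def q_def)
  have aq: "\<alpha> * \<rho> ^ 4 = \<zeta> * q ^ k"
    using k by (simp add: \<alpha>_def q_def mult.assoc power_Suc2[symmetric] del: power_Suc)
  have c: "c = \<alpha> * \<rho> ^ 4 + inverse (\<alpha> * \<rho> ^ 4)"
    unfolding aq c_def \<zeta>_def[symmetric] by (simp add: \<zeta> distrib_left)
  have dq: "d = \<rho> ^ 4 + inverse (\<rho> ^ 4)" by (simp add: d_def q_def)
  \<comment> \<open>This is where the sign of \<open>c\<close> matters. For \<open>k = 1\<close> it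
    gives \<open>c = d\<close>, while the opposite sign would make the sum vanish; for larger
    \<open>k\<close> the modulus of \<open>c\<close> exceeds \<open>d\<close>.\<close>
  have dc: "d + c \<noteq> 0"
  proof (cases "k = 1")
    case True
    then have "c = d" by (simp add: c_def d_def)
    moreover have "d > 0" using q1 by (simp add: d_def add_pos_pos)
    ultimately show ?thesis by simp
  next
    case False
    have "q < q ^ k" using q1 k False by (metis One_nat_def le_neq_implies_less power_one_right power_strict_increasing)
    moreover from this have "1 < q * q ^ k" using q1 by (simp add: less_1_mult)
    ultimately have "d < q ^ k + inverse (q ^ k)"
      unfolding d_def using q1 by (intro add_inverse_strict_mono) simp_all
    moreover have "d > 0" using q1 by (simp add: d_def add_pos_pos)
    moreover have "\<zeta> = 1 \<or> \<zeta> = -1" by (auto simp: \<zeta>_def minus_one_power_iff)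
    ultimately show ?thesis unfolding c_def \<zeta>_def[symmetric] by auto
  qed
  \<comment> \<open>A row with a cap arc is a combination of the two rows in which the arc is pushed
    off the crosscap, so its factor is the same combination; it inherits the factorization and the
    kernel.\<close>
  define X where "X m A = (case m of Free M R \<Rightarrow> state_weight \<rho> \<alpha> (2 * n) (mate M) (Min R) A
    | Cap M a \<Rightarrow> x / (d + c) * (state_weight \<rho> \<alpha> (2 * n) (mate M) (Min (region n M (Min a))) A
        + state_weight \<rho> \<alpha> (2 * n) (mate M) (Min (region n M (Max a))) A))" for m A
  define Y where "Y A m = (case m of Free M R \<Rightarrow> state_weight \<rho> \<beta> (2 * n) (mate M) (Min R) A | Cap M a \<Rightarrow> 0)" for m A
  have min_region: "Min (region n M g) < 2 * n" if "M \<in> NC n" "g < 2 * n" for M g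
    using odd_upto_region(2)[OF that, of "{}"] by simp
  have Free: "poly (ev d x y w (bilinear n (Free M R) (Free M' R'))) c = (\<Sum>A\<in>?\<Sigma>. X (Free M R) A * Y A (Free M' R'))"
    if M: "M \<in> NC n" "M' \<in> NC n" and R: "Min R < 2 * n" "Min R' < 2 * n" for M R M' R'
  proof -
    interpret meander "2 * n" "mate M" "mate M'" "curves n (Free M R) (Free M' R')"
      using meander_curves[of "Free M R" n "Free M' R'"] M by simp
    have "\<alpha> * \<beta> = \<rho> powi (-8)" using nz by (simp add: \<beta>_def)
    from sum_state_weight_mult[OF refl nz this R]
    show ?thesis unfolding poly_bilinear_Free_Free[OF M] X_def Y_def conn.case odd_upto_def c dq by (rule sym)
  qed
  have arc: "Min a < 2 * n" "Max a < 2 * n" if M: "M \<in> NC n" and a: "a \<in> M" for M a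
  proof -
    obtain p where p: "p < 2 * n" "p < mate M p" "a = {p, mate M p}" "Min a = p" "Max a = mate M p"
      by (rule NC_arc_cases[OF M a])
    then show "Min a < 2 * n" "Max a < 2 * n" using nc_involutionD(1)[OF nc_involution_mate[OF M], of p] by auto
  qed
  have "[:-c, 1:] ^ (card (Mb0 n) + card ?T - card ?\<Sigma>) dvd det_on (Mb_1 n) (\<lambda>i j. ev d x y w (bilinear n i j))"
  proof (rule linear_power_dvd_det_on[where X = X and Y = Y and \<psi> = "kernel_vec \<rho>"])
    show "finite (Mb_1 n)" by (rule finite_Mb_1)
    show "Mb0 n \<subseteq> Mb_1 n" by (simp add: Mb_1_def)
    show "finite ?T" "finite ?\<Sigma>" by auto
    show "poly (ev d x y w (bilinear n i j)) c = (\<Sum>A\<in>?\<Sigma>. X i A * Y A j)" if i: "i \<in> Mb_1 n" and j: "j \<in> Mb0 n" for i j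
    proof -
      obtain M' g' where j': "j = Free M' (region n M' g')" and M': "M' \<in> NC n" and g': "g' < 2 * n"
        using j by (auto simp: Mb0_def)
      note r' = min_region[OF M' g']
      from i consider M g where "i = Free M (region n M g)" "M \<in> NC n" "g < 2 * n"
        | M a where "i = Cap M a" "M \<in> NC n" "a \<in> M"
        by (auto simp: Mb_1_def Mb0_def Mb1_def)
      then show ?thesis
      proof cases
        case 1
        then show ?thesis using Free[OF 1(2) M' min_region[OF 1(2,3)] r'] by (simp add: j')
      next
        case 2
        let ?F = "\<lambda>g. Free M (region n M g)"
        note ar = arc[OF 2(2,3)]
        have "(d + c) * poly (ev d x y w (bilinear n i j)) c =
            x * ((\<Sum>A\<in>?\<Sigma>. X (?F (Min a)) A * Y A j) + (\<Sum>A\<in>?\<Sigma>. X (?F (Max a)) A * Y A j))"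
          unfolding 2(1) j' poly_bilinear_Cap_Free[OF 2(2) M' 2(3)]
          using Free[OF 2(2) M' min_region[OF 2(2) ar(1)] r'] Free[OF 2(2) M' min_region[OF 2(2) ar(2)] r'] by simp
        also have "\<dots> = (d + c) * (\<Sum>A\<in>?\<Sigma>. X i A * Y A j)"
          unfolding sum.distrib[symmetric] sum_distrib_left
          using dc by (intro sum.cong refl) (simp add: 2(1) X_def field_simps)
        finally show ?thesis using dc by simp
      qed
    qed
    show "(\<Sum>A\<in>?\<Sigma>. X i A * kernel_vec \<rho> t A) = 0" if i: "i \<in> Mb_1 n" and t: "t \<in> ?T" for i t
    proof -
      have "\<alpha>\<^sup>2 = \<rho> powi (8 * (int k - 1))"
      proof -
        have "\<alpha>\<^sup>2 = (q ^ (k - 1))\<^sup>2" using \<zeta> by (simp add: \<alpha>_def power2_eq_square mult_ac)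
        also have "\<dots> = \<rho> ^ (8 * (k - 1))" by (simp add: q_def flip: power_mult)
        also have "\<dots> = \<rho> powi int (8 * (k - 1))" by (rule power_int_of_nat[symmetric])
        finally show ?thesis using k by (simp add: of_nat_diff)
      qed
      then have ker: "(\<Sum>A\<in>?\<Sigma>. state_weight \<rho> \<alpha> (2 * n) (mate M) (Min (region n M g)) A * kernel_vec \<rho> t A) = 0"
        if "M \<in> NC n" "g < 2 * n" for M g
        using that t \<rho> k nz min_region[OF that]
        by (intro sum_state_weight_kernel_vec[where k = k] nc_involution_mate) auto
      from i consider M g where "i = Free M (region n M g)" "M \<in> NC n" "g < 2 * n"
        | M a where "i = Cap M a" "M \<in> NC n" "a \<in> M"
        by (auto simp: Mb_1_def Mb0_def Mb1_def)
      then show ?thesis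
      proof cases
        case 1
        then show ?thesis using ker[OF 1(2,3)] by (simp add: X_def)
      next
        case 2
        have "(\<Sum>A\<in>?\<Sigma>. X i A * kernel_vec \<rho> t A) = x / (d + c) *
            ((\<Sum>A\<in>?\<Sigma>. state_weight \<rho> \<alpha> (2 * n) (mate M) (Min (region n M (Min a))) A * kernel_vec \<rho> t A)
           + (\<Sum>A\<in>?\<Sigma>. state_weight \<rho> \<alpha> (2 * n) (mate M) (Min (region n M (Max a))) A * kernel_vec \<rho> t A))"
          unfolding sum.distrib[symmetric] sum_distrib_left
          by (intro sum.cong refl) (simp add: 2(1) X_def algebra_simps)
        then show ?thesis using ker[OF 2(2)] arc[OF 2(2,3)] by simp
      qed
    qed
    show "\<forall>t\<in>?T. b t = 0" if "\<And>A. A \<in> ?\<Sigma> \<Longrightarrow> (\<Sum>t\<in>?T. b t * kernel_vec \<rho> t A) = 0" for b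
      using ind that by blast
  qed
  moreover have "card ?T = 2 * n choose (n - k)"
  proof -
    have "card ?T = 2 * n choose (n + k)" using n_subsets[of "{..<2 * n}" "n + k"] by simp
    also have "\<dots> = 2 * n choose (2 * n - (n + k))" using k by (intro binomial_symmetric) simp
    also have "2 * n - (n + k) = n - k" by simp
    finally show ?thesis .
  qed
  \<comment> \<open>By the lower bound on \<open>card (Mb0 n)\<close>, the columns are numerous
    enough for the exponent to reach \<open>card ?T\<close>.\<close>
  moreover have "card ?T \<le> card (Mb0 n) + card ?T - card ?\<Sigma>" using card_Mb0_ge[OF n] by simp
  ultimately show ?thesis
    unfolding d_def[symmetric] gram_det_Mb1_def ev.hom_det_on
    by (metis (no_types, lifting) dvd_trans le_imp_power_dvd)
qed

text \<open>The product of the other factors does not vanish at \<open>z i\<close>, so the whole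
  multiplicity of this root is left in the cofactor \<open>S\<close>.\<close>

lemma prod_linear_powers_dvd:
  fixes P :: "'a::idom poly"
  assumes "finite I" "inj_on z I" "\<And>i. i \<in> I \<Longrightarrow> [:- z i, 1:] ^ m i dvd P"
  shows "(\<Prod>i\<in>I. [:- z i, 1:] ^ m i) dvd P"
  using assms
proof (induction I rule: finite_induct)
  case (insert i I)
  let ?Q = "\<Prod>j\<in>I. [:- z j, 1:] ^ m j"
  have "?Q dvd P" using insert by (intro insert.IH) auto
  then obtain S where S: "P = ?Q * S" by (elim dvdE)
  have "z i \<noteq> z j" if "j \<in> I" for j using insert.prems(1) insert.hyps that by (auto simp: inj_on_def)
  then have Q: "poly ?Q (z i) \<noteq> 0" using insert.hyps by (simp add: poly_prod)
  have "[:- z i, 1:] ^ m i dvd S"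
  proof (cases "P = 0")
    case True
    then show ?thesis using S Q by auto
  next
    case False
    then have "m i \<le> order (z i) P" using insert.prems(2)[of i] by (simp add: order_divides)
    also have "\<dots> = order (z i) ?Q + order (z i) S" using False S by (metis order_mult)
    also have "order (z i) ?Q = 0" using Q by (rule order_0I)
    finally show ?thesis by (simp add: order_divides)
  qed
  then show ?case using insert.hyps by (simp add: S mult.commute mult_dvd_mono)
qed simp

lemma ev_cheb:
  assumes "q \<noteq> 0"
  shows "ev (q + inverse q) x y w (cheb k) = [:q ^ k + inverse (q ^ k):]"
proof (induction k rule: cheb.induct)
  case 1
  have "ev (q + inverse q) x y w 2 = 2" using ev.hom_of_int[of _ _ _ _ 2] by simp
  then show ?case by (simp add: numeral_poly)
next
  case (3 k)
  have "(q + inverse q) * (q ^ Suc k + inverse (q ^ Suc k)) - (q ^ k + inverse (q ^ k))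
      = q ^ Suc (Suc k) + inverse (q ^ Suc (Suc k))"
    using assms by (simp add: field_simps)
  then show ?case using 3 by (simp add: ev.hom_diff ev.hom_mult mult.commute del: power_Suc)
qed simp

lemma cheb_const: "\<exists>c. cheb k = [:[:c:]:]"
proof (induction k rule: cheb.induct)
  case 1
  then show ?case by (auto simp: numeral_poly)
next
  case (3 k)
  then obtain a b where "cheb (Suc k) = [:[:a:]:]" "cheb k = [:[:b:]:]" by blast
  then show ?case by (simp add: var_d_def)
qed (simp add: var_d_def)

lemma unital_ring_hom_const_poly: "unital_ring_hom (\<lambda>c::'a::comm_ring_1. [:c:])"
  by unfold_locales (simp_all add: one_pCons)

theorem mainTheorem1:
  fixes n :: nat
  assumes "n \<ge> 1"
  shows "(\<Prod>k\<in>{1..n}. (cheb k + (-1) ^ k * var_z) ^ (2 * n choose (n - k)))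
           dvd gram_det_Mb1 n"
proof -
  let ?m = "\<lambda>k. 2 * n choose (n - k)"
  let ?ind = "\<lambda>k \<rho>. \<forall>b. (\<forall>A\<in>{A. A \<subseteq> {..<2 * n} \<and> card A = n}.
        (\<Sum>t\<in>{t. t \<subseteq> {..<2 * n} \<and> card t = n + k}. b t * kernel_vec \<rho> t A) = 0)
      \<longrightarrow> (\<forall>t\<in>{t. t \<subseteq> {..<2 * n} \<and> card t = n + k}. b t = 0)"
  \<comment> \<open>There are finitely many \<open>k\<close>, so one interval to the right of 1
    serves all of them.\<close>
  have "eventually (\<lambda>\<rho>. \<forall>k\<in>{1..n}. ?ind k \<rho>) (at_right 1)"
    using kernel_vec_independent_near_one by (intro eventually_ball_finite ballI) simp_all
  then obtain r where r: "r > 1" and ind: "\<And>\<rho> k. 1 < \<rho> \<Longrightarrow> \<rho> < r \<Longrightarrow> k \<in> {1..n} \<Longrightarrow> ?ind k \<rho>"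
    unfolding eventually_at_right_field by blast
  define D where "D = (\<lambda>\<rho>::real. \<rho> ^ 4 + inverse (\<rho> ^ 4)) ` {1<..<r}"
  have "inj_on (\<lambda>\<rho>::real. \<rho> ^ 4 + inverse (\<rho> ^ 4)) {1<..<r}"
  proof (rule inj_onI)
    fix s t :: real assume st: "s \<in> {1<..<r}" "t \<in> {1<..<r}" "s ^ 4 + inverse (s ^ 4) = t ^ 4 + inverse (t ^ 4)"
    have gt: "s ^ 4 > 1" "t ^ 4 > 1" using st by auto
    have "s ^ 4 = t ^ 4"
      by (rule add_inverse_inj[OF _ _ less_1_mult[OF gt] st(3)]) (use gt in linarith)+
    then show "s = t" using st by (simp add: power_eq_iff_eq_base)
  qed
  then have D: "infinite D" unfolding D_def using r by (simp add: finite_image_iff infinite_Ioo)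
  obtain C where C: "\<And>k. cheb k = [:[:C k:]:]" using cheb_const by metis
  define Q where "Q = (\<Prod>k\<in>{1..n}. [:C k, (-1) ^ k:] ^ ?m k)"
  interpret const: unital_ring_hom "\<lambda>c::int poly poly poly poly. [:c:]" by (rule unital_ring_hom_const_poly)
  have "cheb k + (-1) ^ k * var_z = [:[:C k, (-1) ^ k:]:]" for k
    by (cases "even k") (simp_all add: C var_z_def)
  then have Q: "(\<Prod>k\<in>{1..n}. (cheb k + (-1) ^ k * var_z) ^ ?m k) = [:Q:]"
    by (simp add: Q_def const.hom_prod const.hom_power)
  \<comment> \<open>As polynomials in z the factors have leading coefficient 1 or -1, which is what
    division by \<open>Q\<close> over the integers requires.\<close>
  have "lead_coeff Q = (\<Prod>k\<in>{1..n}. ((-1) ^ k) ^ ?m k)"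
    by (simp add: Q_def lead_coeff_prod lead_coeff_power)
  also have "\<dots> dvd (\<Prod>k\<in>{1..n}. 1)"
    by (intro prod_dvd_prod) (auto simp: is_unit_power_iff)
  finally have lc: "lead_coeff Q dvd 1" by simp
  show ?thesis
    unfolding Q
  proof (rule dvd_if_dvd_evaluations[OF lc D])
    fix d x y w assume "d \<in> D"
    then obtain \<rho> where \<rho>: "1 < \<rho>" "\<rho> < r" and d: "d = \<rho> ^ 4 + inverse (\<rho> ^ 4)" by (auto simp: D_def)
    define q where "q = \<rho> ^ 4"
    have q: "q > 1" "d = q + inverse q" using \<rho> by (auto simp: q_def d)
    define z where "z k = - ((-1) ^ k) * (q ^ k + inverse (q ^ k))" for k
    have abs_z: "\<bar>z k\<bar> = q ^ k + inverse (q ^ k)" for k using q by (simp add: z_def abs_mult)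
    \<comment> \<open>The moduli already differ, because t + 1/t is injective on the powers of
      \<open>q > 1\<close> with nonnegative exponents; the alternating signs cannot cause a
      coincidence.\<close>
    have inj: "z j \<noteq> z k" if "j \<noteq> k" for j k
    proof
      assume "z j = z k"
      then have eq: "q ^ j + inverse (q ^ j) = q ^ k + inverse (q ^ k)" using abs_z by metis
      have gt: "1 < q ^ j * q ^ k"
        unfolding power_add[symmetric] using q that by (intro one_less_power) auto
      have "q ^ j = q ^ k" by (rule add_inverse_inj[OF _ _ gt eq]) (use q in simp_all)
      then show False using that q by (simp add: power_inject_exp)
    qed
    have "ev d x y w (cheb k + (-1) ^ k * var_z) = [:(-1) ^ k:] * [:- z k, 1:]" for k
    proof -
      have "ev d x y w ((-1) ^ k) = (-1) ^ k" by (simp add: ev.hom_power ev.hom_uminus ev.hom_one)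
      moreover have "ev d x y w (cheb k) = [:q ^ k + inverse (q ^ k):]" unfolding q(2) using q by (intro ev_cheb) simp
      ultimately show ?thesis by (cases "even k") (simp_all add: ev.hom_add ev.hom_diff ev.hom_mult z_def add.commute)
    qed
    then have "ev d x y w [:Q:] = (\<Prod>k\<in>{1..n}. ([:(-1) ^ k:] * [:- z k, 1:]) ^ ?m k)"
      unfolding Q[symmetric] by (simp only: ev.hom_prod ev.hom_power)
    also have "\<dots> dvd ev d x y w (gram_det_Mb1 n)"
    proof (rule dvd_trans)
      have "[:(-1) ^ k:] * [:- z k, 1:] dvd [:- z k, 1:]" for k
        by (rule dvdI[of _ _ "[:(-1) ^ k:]"]) (cases "even k"; simp)
      then show "(\<Prod>k\<in>{1..n}. ([:(-1) ^ k:] * [:- z k, 1:]) ^ ?m k) dvd (\<Prod>k\<in>{1..n}. [:- z k, 1:] ^ ?m k)"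
        by (intro prod_dvd_prod dvd_power_same)
      show "(\<Prod>k\<in>{1..n}. [:- z k, 1:] ^ ?m k) dvd ev d x y w (gram_det_Mb1 n)"
      proof (rule prod_linear_powers_dvd)
        show "inj_on z {1..n}" using inj by (auto intro: inj_onI)
        show "[:- z k, 1:] ^ ?m k dvd ev d x y w (gram_det_Mb1 n)" if "k \<in> {1..n}" for k
          unfolding q(2) q_def z_def using that \<rho> assms by (intro linear_power_dvd_gram_det ind) auto
      qed simp
    qed
    finally show "ev d x y w [:Q:] dvd ev d x y w (gram_det_Mb1 n)" .
  qed
qed

end
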